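(* For every even positive integer $t$, $$\sum_{\lambda\in \mathcal{SC}}q^{|\lambda|}x^{|\mathcal{H}_t(\lambda)|}b^{\mathrm{BG}(\lambda)}\prod_{h\in\mathcal{H}_t(\lambda)}\frac{1}{h}=\left(q^{2t};q^{2t}\right)_{\infty}^{t/2}\left(-bq;q^4\right)_{\infty}\left(-q^3/b;q^4\right)_{\infty}\exp\left(\frac{x^2q^{2t}}{2t}\right).$$
   Context: A partition is a finite nonincreasing sequence $\lambda=(\lambda_1,\dots,\lambda_\ell)$ of positive integers (the empty partition is allowed), and $|\lambda|$ is the sum of its parts. A partition is identified with its Ferrers diagram, the set of boxes $(i,j)$ (row $i$, column $j$) with $1\le j\le\lambda_i$. The conjugate $\lambda'$ is given by $\lambda'_j=\#\{i:\lambda_i\ge j\}$; $\mathcal{SC}$ is the set of self-conjugate partitions ($\lambda=\lambda'$). The hook-length of a box $(i,j)$ is $\lambda_i-j+\lambda'_j-i+1$; $\mathcal{H}_t(\lambda)$ is the multiset of hook-lengths of $\lambda$ divisible by $t$ (cardinality and products are taken with multiplicity; empty products are $1$). The BG-rank is $\mathrm{BG}(\lambda)=\sum_{(i,j)\in\lambda}(-1)^{i+j}$. Also $(a;q)_\infty=\prod_{j\ge0}(1-aq^j)$. The identity is one of formal power series in $q$ whose coefficients are polynomials in $x,b,b^{-1}$. *)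

theory Defs
  imports
    "HOL-Analysis.Analysis"
    "HOL-Library.Poly_Mapping"
    "HOL-Library.Multiset"
begin

section \<open>Partitions\<close>

definition is_partition :: "nat list \<Rightarrow> bool" where
  "is_partition \<mu> \<longleftrightarrow> sorted_wrt (\<ge>) \<mu> \<and> 0 \<notin> set \<mu>"

text \<open>Rows and columns are numbered from 1, and parts beyond the length are 0.\<close>

definition part :: "nat list \<Rightarrow> nat \<Rightarrow> nat" where
  "part \<mu> i = (if 1 \<le> i \<and> i \<le> length \<mu> then \<mu> ! (i - 1) else 0)"

definition diagram :: "nat list \<Rightarrow> (nat \<times> nat) set" where
  "diagram \<mu> = {(i, j). 1 \<le> i \<and> i \<le> length \<mu> \<and> 1 \<le> j \<and> j \<le> part \<mu> i}"

lemma finite_diagram: "finite (diagram \<mu>)"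
proof -
  have "diagram \<mu> = (SIGMA i:{1..length \<mu>}. {1..part \<mu> i})"
    by (auto simp: diagram_def)
  then show ?thesis by simp
qed

definition conjugate :: "nat list \<Rightarrow> nat list" where
  "conjugate \<mu> = map (\<lambda>j. card {i \<in> {1..length \<mu>}. j \<le> part \<mu> i}) [1..<Suc (part \<mu> 1)]"

definition SC :: "nat list set" where
  "SC = {\<mu>. is_partition \<mu> \<and> conjugate \<mu> = \<mu>}"

text \<open>
  The summands of the hook length are grouped so that neither subtraction truncates
  when \<open>(i, j)\<close> is a box of the diagram of the partition \<open>\<mu>\<close>.
\<close>

definition hook_length :: "nat list \<Rightarrow> nat \<times> nat \<Rightarrow> nat" where
  "hook_length \<mu> = (\<lambda>(i, j). (part \<mu> i - j) + (part (conjugate \<mu>) j - i) + 1)"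

definition hooks_div :: "nat \<Rightarrow> nat list \<Rightarrow> nat multiset" where
  "hooks_div t \<mu> = {# h \<in># image_mset (hook_length \<mu>) (mset_set (diagram \<mu>)). t dvd h #}"

definition BG_rank :: "nat list \<Rightarrow> int" where
  "BG_rank \<mu> = (\<Sum>(i, j)\<in>diagram \<mu>. (- 1) ^ (i + j))"

section \<open>The coefficient ring\<close>

text \<open>
  The ring of polynomials in \<open>x\<close>, \<open>b\<close>, \<open>b\<inverse>\<close> over the rationals, as the monoid algebra of
  \<open>\<nat> \<times> \<int>\<close>: the exponent \<open>(m, k)\<close> stands for the monomial \<open>x\<^sup>m b\<^sup>k\<close>.
\<close>

type_synonym coeff_ring = "(nat \<times> int) \<Rightarrow>\<^sub>0 rat"

definition scalar :: "rat \<Rightarrow> coeff_ring" where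
  "scalar c = Poly_Mapping.single (0, 0) c"

definition x_var :: coeff_ring where
  "x_var = Poly_Mapping.single (1, 0) 1"

definition b_pow :: "int \<Rightarrow> coeff_ring" where
  "b_pow k = Poly_Mapping.single (0, k) 1"

section \<open>Power series\<close>

text \<open>
  Limits are taken in the metric topology of \<^typ>\<open>'a fps\<close>, that is, each coefficient is
  eventually constant.
\<close>

definition qpoch_inf :: "'a::comm_ring_1 fps \<Rightarrow> 'a fps \<Rightarrow> 'a fps" where
  "qpoch_inf a q = prodinf (\<lambda>j. 1 - a * q ^ j)"

text \<open>The infinite product converges whenever both arguments have constant term 0.\<close>

lemma has_prod_qpoch_inf:
  fixes a q :: "'a::comm_ring_1 fps"
  assumes a: "fps_nth a 0 = 0" and q: "fps_nth q 0 = 0"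
  shows "(\<lambda>j. 1 - a * q ^ j) has_prod qpoch_inf a q"
proof -
  define P where "P n = (\<Prod>j\<le>n. 1 - a * q ^ j)" for n
  define L where "L = Abs_fps (\<lambda>k. fps_nth (P k) k)"
  have step: "fps_nth (P (Suc n)) k = fps_nth (P n) k" if "k \<le> n" for n k
  proof -
    have "fps_nth (P n * a * q ^ Suc n) k = 0"
      unfolding fps_mult_nth[of "P n * a"]
      by (rule sum.neutral) (use that startsby_zero_power_prefix[OF q, of "Suc n"] in auto)
    moreover have "P (Suc n) = P n - P n * a * q ^ Suc n"
      by (simp add: P_def algebra_simps)
    ultimately show ?thesis by simp
  qed
  have stable: "fps_nth (P n) k = fps_nth L k" if "k \<le> n" for n k
    using that
    by (induction n rule: dec_induct) (simp_all add: L_def step)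
  have "P \<longlonglongrightarrow> L"
    by (rule tendsto_fpsI) (use stable in \<open>auto simp: eventually_sequentially\<close>)
  moreover have "fps_nth L 0 = 1"
    using stable[of 0 0] a by (simp add: P_def)
  ultimately have "(\<lambda>j. 1 - a * q ^ j) has_prod L"
    by (auto simp: has_prod_def raw_has_prod_def P_def[abs_def])
  moreover have "L' = L" if "(\<lambda>j. 1 - a * q ^ j) has_prod L'" for L'
  proof -
    have ne: "1 - a * q ^ j \<noteq> 0" for j
    proof
      assume "1 - a * q ^ j = 0"
      then have "fps_nth (1 - a * q ^ j) 0 = 0" by simp
      then show False using a by simp
    qed
    then have "P \<longlonglongrightarrow> L'"
      using that by (auto simp: has_prod_def raw_has_prod_def P_def[abs_def])
    then show ?thesis using \<open>P \<longlonglongrightarrow> L\<close> LIMSEQ_unique by blast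
  qed
  ultimately show ?thesis
    unfolding qpoch_inf_def prodinf_def by (rule theI)
qed

text \<open>
  The exponential series \<open>\<Sum>n. f\<^sup>n / n!\<close>, for \<open>f\<close> with constant term 0. The library's
  \<^const>\<open>fps_exp\<close> divides in the coefficients, which is not possible here.
\<close>

definition exp_series :: "coeff_ring fps \<Rightarrow> coeff_ring fps" where
  "exp_series f = Abs_fps (\<lambda>n. scalar (1 / fact n)) oo f"

end

theory Submission
  imports Defs
begin

text \<open>
  A self-conjugate partition \<open>\<mu>\<close> is the set \<open>S = {\<mu>\<^sub>i - i | i \<ge> 1}\<close> of integers, which satisfies
  \<open>- 1 - k \<in> S \<longleftrightarrow> k \<notin> S\<close>. Its hooks are the pairs \<open>b < a\<close> with \<open>a \<in> S\<close>, \<open>b \<notin> S\<close>, and its size and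
  BG-rank are \<open>\<Sum> (2 k + 1)\<close> and \<open>\<Sum> (- 1)\<^sup>k\<close> over the nonnegative \<open>k \<in> S\<close>. Hooks divisible by \<open>t\<close> live
  in a single residue class modulo \<open>t\<close>, and since \<open>t\<close> is even, \<open>S\<close> amounts to \<open>t / 2\<close> arbitrary Maya
  diagrams, each of which accounts for two mirror classes. A Maya diagram is a charge \<open>c\<close> and a
  partition \<open>\<nu>\<close>, and the size and BG-rank depend on \<open>c\<close> and \<open>|\<nu>|\<close> only.

  Hence the sum is \<open>\<Theta> E\<^sup>t\<^sup>/\<^sup>2\<close>, where \<open>\<Theta>\<close> sums over the charges and
  \<open>E = exp (x\<^sup>2 q\<^sup>2\<^sup>t / t\<^sup>2)\<close> by \<open>\<Sum>\<^sub>\<nu> \<Prod> 1 / h\<^sup>2 = 1 / n!\<close>. Without hook weights the same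
  argument gives \<open>\<Theta> P\<^sup>t\<^sup>/\<^sup>2\<close>, where \<open>P\<close> is the partition generating function in \<open>q\<^sup>2\<^sup>t\<close>, while directly
  this sum is \<open>\<Prod> (1 + b\<^sup>\<plusminus>\<^sup>1 q\<^sup>2\<^sup>k\<^sup>+\<^sup>1)\<close>. Comparing the two evaluates \<open>\<Theta>\<close> without the triple product
  identity.
\<close>

section \<open>Inverse hook products of beta sets\<close>

text \<open>Mirror classes carry equal hooks, so each of the \<open>t / 2\<close> slices enters with
  squared weights. This is why the summable quantity is the inverse square of the hook product, and
  the constant in the exponent is \<open>(t / 2) / t\<^sup>2 = 1 / (2 t)\<close>. The identity with
  \<open>1 / n!\<close> is obtained without tableaux. For the inverse hook product \<open>w\<close>
  of a partition of \<open>n\<close>, the inverse hook products after adding one box sum to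
  \<open>w\<close>, and after removing one box to \<open>n w\<close>. Both facts come from the
  rational function with factors \<open>1 + e / (z - j)\<close>, where \<open>j\<close> runs over
  the beta numbers: adding uses \<open>e = 1\<close> and the value at \<open>z = - 1\<close>,
  removing uses \<open>e = - 1\<close> and the behaviour at infinity. Adding a box needs room for a
  new row, so beta sets with more numbers than boxes are used there. The coefficient ring has no
  division. The partition series is therefore cancelled by multiplying with its explicit inverse,
  and hook weights stay general for as long as possible, so that literally the same theta factor
  occurs in both evaluations.\<close>

text \<open>The product over \<open>j\<close> has simple poles at the points of \<open>B\<close>,
  with residue \<open>e * u B a\<close> at \<open>a\<close>, which gives the first claim. The other
  two compare the coefficients of \<open>1 / z\<close> and \<open>1 / z\<^sup>2\<close> at infinity;
  the last is doubled to avoid dividing by 2 in an arbitrary field. The proof replaces the analysis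
  by induction on \<open>B\<close>.\<close>

lemma partial_fractions:
  fixes B :: "'a::field set" and e :: 'a
  assumes "finite B"
  defines "u \<equiv> \<lambda>B a. \<Prod>j\<in>B - {a}. 1 + e / (a - j)"
  shows "z \<notin> B \<Longrightarrow> (\<Prod>j\<in>B. 1 + e / (z - j)) = 1 + e * (\<Sum>a\<in>B. u B a / (z - a))"
    and "(\<Sum>a\<in>B. u B a) = of_nat (card B)"
    and "2 * (\<Sum>a\<in>B. a * u B a) = 2 * \<Sum>B + e * (of_nat (card B) * (of_nat (card B) - 1))"
proof -
  have "(\<forall>z. z \<notin> B \<longrightarrow> (\<Prod>j\<in>B. 1 + e / (z - j)) = 1 + e * (\<Sum>a\<in>B. u B a / (z - a)))
    \<and> (\<Sum>a\<in>B. u B a) = of_nat (card B)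
    \<and> 2 * (\<Sum>a\<in>B. a * u B a) = 2 * \<Sum>B + e * (of_nat (card B) * (of_nat (card B) - 1))"
    using assms(1)
  proof (induction B rule: finite_induct)
    case empty
    then show ?case by simp
  next
    case (insert c B)
    have IH1: "(\<Prod>j\<in>B. 1 + e / (z - j)) = 1 + e * (\<Sum>a\<in>B. u B a / (z - a))" if "z \<notin> B" for z
      using insert.IH that by blast
    have IH2: "(\<Sum>a\<in>B. u B a) = of_nat (card B)"
      and IH3: "2 * (\<Sum>a\<in>B. a * u B a) = 2 * \<Sum>B + e * (of_nat (card B) * (of_nat (card B) - 1))"
      using insert.IH by blast+
    have uc: "u (insert c B) c = 1 + e * (\<Sum>a\<in>B. u B a / (c - a))"
      using IH1[of c] insert.hyps by (simp add: u_def)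
    have ua: "u (insert c B) a = u B a - e * (u B a / (c - a))" if "a \<in> B" for a
    proof -
      have ac: "a \<noteq> c" using that insert.hyps by auto
      have "insert c B - {a} = insert c (B - {a})" using ac by auto
      then have "u (insert c B) a = (1 + e / (a - c)) * u B a"
        unfolding u_def using insert.hyps by simp
      moreover have "e / (a - c) = - (e / (c - a))"
        by (metis minus_diff_eq minus_divide_right)
      ultimately show ?thesis by (simp add: algebra_simps)
    qed
    \<comment> \<open>All three claims are instances: \<open>k a\<close> is
      \<open>1 / (z - a)\<close>, 1 or \<open>a\<close>. In each case the factor
      \<open>k c - k a\<close> vanishes or cancels the denominator \<open>c - a\<close>.\<close>
    have sum_split: "(\<Sum>a\<in>insert c B. k a * u (insert c B) a)
        = (\<Sum>a\<in>B. k a * u B a) + k c + e * (\<Sum>a\<in>B. (k c - k a) * (u B a / (c - a)))" for k :: "'a \<Rightarrow> 'a"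
    proof -
      have "(\<Sum>a\<in>insert c B. k a * u (insert c B) a)
          = k c * u (insert c B) c + (\<Sum>a\<in>B. k a * u (insert c B) a)"
        using insert.hyps by simp
      also have "(\<Sum>a\<in>B. k a * u (insert c B) a) = (\<Sum>a\<in>B. k a * (u B a - e * (u B a / (c - a))))"
        by (rule sum.cong) (simp_all add: ua)
      also have "\<dots> = (\<Sum>a\<in>B. k a * u B a) - e * (\<Sum>a\<in>B. k a * (u B a / (c - a)))"
        unfolding sum_distrib_left sum_subtractf[symmetric]
        by (rule sum.cong) (simp_all add: algebra_simps)
      finally have "(\<Sum>a\<in>insert c B. k a * u (insert c B) a) = k c * u (insert c B) c
          + ((\<Sum>a\<in>B. k a * u B a) - e * (\<Sum>a\<in>B. k a * (u B a / (c - a))))" .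
      moreover have "(\<Sum>a\<in>B. (k c - k a) * (u B a / (c - a)))
          = k c * (\<Sum>a\<in>B. u B a / (c - a)) - (\<Sum>a\<in>B. k a * (u B a / (c - a)))"
        by (simp only: left_diff_distrib sum_subtractf sum_distrib_left)
      ultimately show ?thesis unfolding uc by (simp only:) (simp add: algebra_simps)
    qed
    have "(\<Prod>j\<in>insert c B. 1 + e / (z - j)) = 1 + e * (\<Sum>a\<in>insert c B. u (insert c B) a / (z - a))"
      if z: "z \<notin> insert c B" for z
    proof -
      have zc: "z - c \<noteq> 0" using z by auto
      have *: "(1 / (z - c) - 1 / (z - a)) * (u B a / (c - a)) = u B a / (z - a) / (z - c)" if "a \<in> B" for a
      proof -
        have "z - a \<noteq> 0" "c - a \<noteq> 0" using that z insert.hyps by auto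
        then have "1 / (z - c) - 1 / (z - a) = (c - a) / ((z - a) * (z - c))"
          using zc by (simp add: divide_simps)
        then show ?thesis using \<open>c - a \<noteq> 0\<close> by simp
      qed
      have "(\<Sum>a\<in>insert c B. u (insert c B) a / (z - a))
          = (\<Sum>a\<in>B. u B a / (z - a)) + 1 / (z - c) + e * (\<Sum>a\<in>B. u B a / (z - a) / (z - c))"
        using sum_split[of "\<lambda>a. 1 / (z - a)"] * by simp
      also have "\<dots> = (\<Sum>a\<in>B. u B a / (z - a)) + 1 / (z - c) + e * ((\<Sum>a\<in>B. u B a / (z - a)) / (z - c))"
        by (simp add: sum_divide_distrib)
      finally show ?thesis
        using insert.hyps z IH1[of z] by (simp add: algebra_simps add_divide_distrib)
    qed
    moreover have "(\<Sum>a\<in>insert c B. u (insert c B) a) = of_nat (card (insert c B))"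
      using sum_split[of "\<lambda>_. 1"] insert.hyps by (simp add: IH2)
    moreover have "2 * (\<Sum>a\<in>insert c B. a * u (insert c B) a) = 2 * \<Sum>(insert c B)
        + e * (of_nat (card (insert c B)) * (of_nat (card (insert c B)) - 1))"
    proof -
      have "(\<Sum>a\<in>B. (c - a) * (u B a / (c - a))) = (\<Sum>a\<in>B. u B a)"
        using insert.hyps by (intro sum.cong) auto
      then have "(\<Sum>a\<in>insert c B. a * u (insert c B) a) = (\<Sum>a\<in>B. a * u B a) + c + e * of_nat (card B)"
        using sum_split[of "\<lambda>a. a"] IH2 by simp
      then have "2 * (\<Sum>a\<in>insert c B. a * u (insert c B) a)
          = 2 * (\<Sum>a\<in>B. a * u B a) + 2 * c + 2 * e * of_nat (card B)" by (simp add: algebra_simps)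
      then show ?thesis unfolding IH3 using insert.hyps by (simp add: algebra_simps)
    qed
    ultimately show ?case by blast
  qed
  then show "z \<notin> B \<Longrightarrow> (\<Prod>j\<in>B. 1 + e / (z - j)) = 1 + e * (\<Sum>a\<in>B. u B a / (z - a))"
    and "(\<Sum>a\<in>B. u B a) = of_nat (card B)"
    and "2 * (\<Sum>a\<in>B. a * u B a) = 2 * \<Sum>B + e * (of_nat (card B) * (of_nat (card B) - 1))"
    by blast+
qed

text \<open>
  A set \<open>B\<close> of \<open>N\<close> natural numbers is the set of beta numbers of a partition with at most \<open>N\<close> parts.
  The pairs in \<open>beta_pairs B\<close> correspond to the boxes of that partition, with \<open>a - b\<close> as hook length,
  so \<open>beta_weight\<close> is the inverse product of the hook lengths and \<open>beta_vand\<close> is Frobenius' formula for it.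
\<close>

definition beta_pairs :: "nat set \<Rightarrow> (nat \<times> nat) set" where
  "beta_pairs B = {(a, b). a \<in> B \<and> b \<notin> B \<and> b < a}"

definition beta_weight :: "nat set \<Rightarrow> rat" where
  "beta_weight B = (\<Prod>(a, b)\<in>beta_pairs B. 1 / (of_nat a - of_nat b))"

definition beta_vand :: "nat set \<Rightarrow> rat" where
  "beta_vand B = (\<Prod>(a, b)\<in>{(a, b). a \<in> B \<and> b \<in> B \<and> b < a}. of_nat a - of_nat b) / (\<Prod>a\<in>B. fact a)"

text \<open>For fixed \<open>a\<close> the differences \<open>a - b\<close> over all
  \<open>b < a\<close> multiply to \<open>a!\<close>. Splitting them by whether \<open>b\<close>
  lies in \<open>B\<close> trades the factors at the holes for those inside
  \<open>B\<close>.\<close>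

lemma beta_weight_eq_vand:
  assumes "finite B"
  shows "beta_weight B = beta_vand B"
proof -
  have f: "(\<Prod>b\<in>{..<a}. of_nat a - of_nat b :: rat) = fact a" for a :: nat
  proof -
    have "(\<Prod>b\<in>{..<a}. of_nat a - of_nat b :: rat) = (\<Prod>b\<in>{..<a}. of_nat (a - b))"
      by (rule prod.cong) (auto simp: of_nat_diff)
    also have "\<dots> = (\<Prod>b\<in>{1..a}. of_nat b)"
      by (rule prod.reindex_bij_witness[of _ "\<lambda>b. a - b" "\<lambda>b. a - b"]) auto
    finally show ?thesis by (simp add: fact_prod)
  qed
  have s1: "{(a, b). a \<in> B \<and> b \<notin> B \<and> b < a} = (SIGMA a:B. {..<a} - B)"
    and s2: "{(a, b). a \<in> B \<and> b \<in> B \<and> b < a} = (SIGMA a:B. {..<a} \<inter> B)" by auto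
  have "beta_weight B = (\<Prod>a\<in>B. \<Prod>b\<in>{..<a} - B. 1 / (of_nat a - of_nat b))"
    unfolding beta_weight_def beta_pairs_def s1 by (subst prod.Sigma) (use assms in auto)
  also have "\<dots> = (\<Prod>a\<in>B. (\<Prod>b\<in>{..<a} \<inter> B. of_nat a - of_nat b) / fact a)"
  proof (rule prod.cong[OF refl])
    fix a
    have "fact a = (\<Prod>b\<in>{..<a} \<inter> B. of_nat a - of_nat b :: rat) * (\<Prod>b\<in>{..<a} - B. of_nat a - of_nat b)"
      unfolding f[symmetric]
      by (subst prod.union_disjoint[symmetric]) (auto intro!: prod.cong)
    moreover have "(\<Prod>b\<in>{..<a} \<inter> B. of_nat a - of_nat b :: rat) \<noteq> 0" by auto
    moreover have "(\<Prod>b\<in>{..<a} - B. 1 / (of_nat a - of_nat b :: rat)) = 1 / (\<Prod>b\<in>{..<a} - B. of_nat a - of_nat b)"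
      by (simp add: prod_dividef)
    ultimately show "(\<Prod>b\<in>{..<a} - B. 1 / (of_nat a - of_nat b :: rat)) = (\<Prod>b\<in>{..<a} \<inter> B. of_nat a - of_nat b) / fact a"
      by simp
  qed
  also have "\<dots> = beta_vand B"
    unfolding beta_vand_def s2 by (subst prod.Sigma[symmetric]) (use assms in \<open>auto simp: prod_dividef\<close>)
  finally show ?thesis .
qed

text \<open>In the form \<open>beta_vand\<close> a new number only adds factors, one for each pair
  with an old number. It may be the larger or the smaller one of the pair, hence the absolute
  values.\<close>

lemma beta_weight_insert:
  assumes "finite C" "a \<notin> C"
  shows "beta_weight (insert a C) = beta_weight C * (\<Prod>j\<in>C. \<bar>of_nat a - of_nat j\<bar>) / fact a"
proof -
  let ?P = "\<lambda>B. {(a, b). a \<in> B \<and> b \<in> B \<and> b < a}"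
  have fin: "finite (?P C)" by (rule finite_subset[of _ "C \<times> C"]) (use assms in auto)
  have split: "?P (insert a C) = ?P C \<union> ((\<lambda>j. (max a j, min a j)) ` C)"
  proof (intro equalityI subsetI)
    fix p assume "p \<in> ?P (insert a C)"
    then obtain c d where p: "p = (c, d)" "c \<in> insert a C" "d \<in> insert a C" "d < c" by auto
    then consider "c \<in> C" "d \<in> C" | "c = a" "d \<in> C" | "c \<in> C" "d = a" by auto
    then show "p \<in> ?P C \<union> ((\<lambda>j. (max a j, min a j)) ` C)"
      by cases (use p in \<open>auto intro: image_eqI[of _ _ c] image_eqI[of _ _ d]\<close>)
  next
    fix p assume "p \<in> ?P C \<union> ((\<lambda>j. (max a j, min a j)) ` C)"
    moreover have "(max a j, min a j) \<in> ?P (insert a C)" if "j \<in> C" for j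
      using that assms(2) by (cases a j rule: linorder_cases) auto
    ultimately show "p \<in> ?P (insert a C)" by auto
  qed
  have inj: "inj_on (\<lambda>j. (max a j, min a j)) C"
    using assms by (auto simp: inj_on_def max_def min_def split: if_splits)
  have "(\<Prod>(a, b)\<in>?P (insert a C). of_nat a - of_nat b :: rat)
      = (\<Prod>(a, b)\<in>?P C. of_nat a - of_nat b) * (\<Prod>(a, b)\<in>(\<lambda>j. (max a j, min a j)) ` C. of_nat a - of_nat b)"
    unfolding split
    by (rule prod.union_disjoint) (use fin assms in \<open>auto simp: max_def min_def split: if_splits\<close>)
  also have "(\<Prod>(a, b)\<in>(\<lambda>j. (max a j, min a j)) ` C. of_nat a - of_nat b :: rat) = (\<Prod>j\<in>C. \<bar>of_nat a - of_nat j\<bar>)"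
    unfolding prod.reindex[OF inj] by (rule prod.cong) (auto simp: max_def min_def)
  finally show ?thesis
    using assms by (simp add: beta_weight_eq_vand beta_vand_def)
qed

text \<open>Taking \<open>a\<close> out and putting \<open>a'\<close> in are two uses of
  \<open>beta_weight_insert\<close>. The cases \<open>e = 1\<close> and \<open>e = - 1\<close> are
  adding and removing a box.\<close>

lemma beta_weight_move:
  fixes a a' :: nat and e :: rat
  assumes "finite B" "a \<in> B" "a' \<notin> B" "of_nat a' = of_nat a + e" "\<bar>e\<bar> = 1"
  shows "beta_weight (insert a' (B - {a}))
    = beta_weight B * (fact a / fact a') * (\<Prod>j\<in>B - {a}. 1 + e / (of_nat a - of_nat j))"
proof -
  let ?C = "B - {a}"
  have r: "\<bar>of_nat a' - of_nat j\<bar> = \<bar>of_nat a - of_nat j\<bar> * (1 + e / (of_nat a - of_nat j))"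
    if "j \<in> ?C" for j :: nat
  proof -
    define d :: int where "d = int a - int j"
    have d: "of_nat a - of_nat j = (of_int d :: rat)" and "d \<noteq> 0"
      using that by (auto simp: d_def)
    \<comment> \<open>A nonzero integer has absolute value at least 1, which is that of
      \<open>e\<close>, so adding \<open>e\<close> cannot reverse its sign.\<close>
    have "of_int d \<ge> (1 :: rat) \<or> of_int d \<le> (- 1 :: rat)"
      using \<open>d \<noteq> 0\<close> by linarith
    then have "\<bar>of_int d + e\<bar> = \<bar>of_int d\<bar> * (1 + e / (of_int d :: rat))"
    proof
      assume D: "of_int d \<ge> (1 :: rat)"
      with assms(5) have "\<bar>of_int d + e\<bar> = of_int d + e" "\<bar>of_int d :: rat\<bar> = of_int d" by linarith+
      with D show ?thesis by (simp add: field_simps)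
    next
      assume D: "of_int d \<le> (- 1 :: rat)"
      with assms(5) have "\<bar>of_int d + e\<bar> = - (of_int d + e)" "\<bar>of_int d :: rat\<bar> = - of_int d" by linarith+
      with D show ?thesis by (simp add: field_simps)
    qed
    then show ?thesis unfolding assms(4) d[symmetric] by (simp add: algebra_simps)
  qed
  have "beta_weight (insert a' ?C) = beta_weight ?C * (\<Prod>j\<in>?C. \<bar>of_nat a' - of_nat j\<bar>) / fact a'"
    using assms by (intro beta_weight_insert) auto
  also have "(\<Prod>j\<in>?C. \<bar>of_nat a' - of_nat j\<bar> :: rat)
      = (\<Prod>j\<in>?C. \<bar>of_nat a - of_nat j\<bar>) * (\<Prod>j\<in>?C. 1 + e / (of_nat a - of_nat j))"
    unfolding prod.distrib[symmetric] by (rule prod.cong) (simp_all add: r)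
  finally have "beta_weight (insert a' ?C) = beta_weight ?C
      * ((\<Prod>j\<in>?C. \<bar>of_nat a - of_nat j\<bar>) * (\<Prod>j\<in>?C. 1 + e / (of_nat a - of_nat j))) / fact a'" .
  moreover have "beta_weight B = beta_weight ?C * (\<Prod>j\<in>?C. \<bar>of_nat a - of_nat j\<bar>) / fact a"
    using beta_weight_insert[of ?C a] assms by (simp add: insert_absorb)
  ultimately show ?thesis by simp
qed

text \<open>This is the partial fraction expansion for \<open>e = 1\<close> at
  \<open>z = - 1\<close>. That 0 is in \<open>B\<close> means that the partition has a zero part, so
  that a new row can be opened.\<close>

lemma sum_beta_weight_up:
  assumes "finite B" "0 \<in> B"
  shows "(\<Sum>a\<in>{a\<in>B. Suc a \<notin> B}. beta_weight (insert (Suc a) (B - {a}))) = beta_weight B"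
proof -
  define u :: "nat \<Rightarrow> rat" where "u a = (\<Prod>j\<in>B - {a}. 1 + 1 / (of_nat a - of_nat j))" for a
  define B' :: "rat set" where "B' = of_nat ` B"
  have inj: "inj_on (of_nat :: nat \<Rightarrow> rat) A" for A by (simp add: inj_on_def)
  have u': "(\<Prod>j\<in>B' - {of_nat a}. 1 + 1 / (of_nat a - j)) = u a" for a
  proof -
    have "B' - {of_nat a} = of_nat ` (B - {a})" by (auto simp: B'_def)
    then show ?thesis by (simp add: u_def prod.reindex[OF inj])
  qed
  \<comment> \<open>The factor for \<open>j = 0\<close> vanishes.\<close>
  have "(\<Prod>j\<in>B'. 1 + 1 / (- 1 - j)) = 0"
    by (rule prod_zero) (use assms in \<open>auto simp: B'_def intro!: bexI[of _ 0]\<close>)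
  moreover have "finite B'" using assms by (simp add: B'_def)
  moreover have "- 1 \<notin> B'"
  proof
    assume "- 1 \<in> B'"
    then obtain n where "(of_nat n :: rat) = - 1" by (auto simp: B'_def)
    then show False using of_nat_0_le_iff[of n, where 'a = rat] by simp
  qed
  ultimately have "1 + (\<Sum>a\<in>B'. (\<Prod>j\<in>B' - {a}. 1 + 1 / (a - j)) / (- 1 - a)) = 0"
    using partial_fractions(1)[of B' "- 1" 1] \<open>finite B'\<close> by simp
  also have "(\<Sum>a\<in>B'. (\<Prod>j\<in>B' - {a}. 1 + 1 / (a - j)) / (- 1 - a)) = (\<Sum>a\<in>B. u a / (- 1 - of_nat a))"
    unfolding B'_def sum.reindex[OF inj] by (simp add: u'[unfolded B'_def])
  also have "\<dots> = - (\<Sum>a\<in>B. u a / of_nat (Suc a))"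
    unfolding sum_negf[symmetric]
  proof (rule sum.cong[OF refl])
    fix a
    have "- 1 - of_nat a = - (of_nat (Suc a) :: rat)" by simp
    then show "u a / (- 1 - of_nat a) = - (u a / of_nat (Suc a))"
      by (metis minus_divide_right)
  qed
  finally have s: "(\<Sum>a\<in>B. u a / of_nat (Suc a)) = 1" by simp
  have "(\<Sum>a\<in>{a\<in>B. Suc a \<notin> B}. beta_weight (insert (Suc a) (B - {a})))
      = (\<Sum>a\<in>{a\<in>B. Suc a \<notin> B}. beta_weight B * (u a / of_nat (Suc a)))"
  proof (rule sum.cong[OF refl])
    fix a assume "a \<in> {a\<in>B. Suc a \<notin> B}"
    then show "beta_weight (insert (Suc a) (B - {a})) = beta_weight B * (u a / of_nat (Suc a))"
      using beta_weight_move[of B a "Suc a" 1] assms by (simp add: u_def)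
  qed
  also have "\<dots> = (\<Sum>a\<in>B. beta_weight B * (u a / of_nat (Suc a)))"
  proof (rule sum.mono_neutral_left)
    \<comment> \<open>A blocked move contributes nothing: if \<open>Suc a\<close> is in
      \<open>B\<close>, then its factor in \<open>u a\<close> is
      \<open>1 + 1 / (- 1) = 0\<close>.\<close>
    show "\<forall>a\<in>B - {a\<in>B. Suc a \<notin> B}. beta_weight B * (u a / of_nat (Suc a)) = 0"
    proof
      fix a assume "a \<in> B - {a\<in>B. Suc a \<notin> B}"
      then have "Suc a \<in> B - {a}" by auto
      then have "u a = 0" unfolding u_def using assms(1) by (intro prod_zero) (auto intro!: bexI[of _ "Suc a"])
      then show "beta_weight B * (u a / of_nat (Suc a)) = 0" by simp
    qed
  qed (use assms in auto)
  also have "\<dots> = beta_weight B" unfolding sum_distrib_left[symmetric] s by simp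
  finally show ?thesis .
qed

text \<open>Here \<open>e = - 1\<close>, and the quotient of factorials in
  \<open>beta_weight_move\<close> supplies the factor \<open>a\<close> of the third claim of
  \<open>partial_fractions\<close>. For \<open>B\<close> in \<open>beta_sets N n\<close> the last
  bracket is \<open>2 * n\<close>.\<close>

lemma sum_beta_weight_down:
  assumes "finite B"
  shows "2 * (\<Sum>a\<in>{a. Suc a \<in> B \<and> a \<notin> B}. beta_weight (insert a (B - {Suc a})))
    = beta_weight B * (2 * of_nat (\<Sum>B) - of_nat (card B) * (of_nat (card B) - 1))"
proof -
  define e :: rat where "e = - 1"
  define u :: "nat \<Rightarrow> rat" where "u a = (\<Prod>j\<in>B - {a}. 1 + e / (of_nat a - of_nat j))" for a
  define B' :: "rat set" where "B' = of_nat ` B"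
  have inj: "inj_on (of_nat :: nat \<Rightarrow> rat) A" for A by (simp add: inj_on_def)
  have u': "(\<Prod>j\<in>B' - {of_nat a}. 1 + e / (of_nat a - j)) = u a" for a
  proof -
    have "B' - {of_nat a} = of_nat ` (B - {a})" by (auto simp: B'_def)
    then show ?thesis by (simp add: u_def prod.reindex[OF inj])
  qed
  have "2 * (\<Sum>a\<in>B'. a * (\<Prod>j\<in>B' - {a}. 1 + e / (a - j)))
      = 2 * \<Sum>B' + e * (of_nat (card B') * (of_nat (card B') - 1))"
    by (rule partial_fractions(3)) (use assms in \<open>auto simp: B'_def\<close>)
  then have s: "2 * (\<Sum>a\<in>B. of_nat a * u a) = 2 * of_nat (\<Sum>B) - of_nat (card B) * (of_nat (card B) - 1)"
    unfolding B'_def sum.reindex[OF inj] card_image[OF inj] by (simp add: u'[unfolded B'_def]) (simp add: e_def)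
  have "(\<Sum>a\<in>{a. Suc a \<in> B \<and> a \<notin> B}. beta_weight (insert a (B - {Suc a})))
      = (\<Sum>a\<in>{a. Suc a \<in> B \<and> a \<notin> B}. beta_weight B * (of_nat (Suc a) * u (Suc a)))"
  proof (rule sum.cong[OF refl])
    fix a assume "a \<in> {a. Suc a \<in> B \<and> a \<notin> B}"
    then have "beta_weight (insert a (B - {Suc a})) = beta_weight B * (fact (Suc a) / fact a) * u (Suc a)"
      unfolding u_def by (intro beta_weight_move) (use assms in \<open>auto simp: e_def\<close>)
    moreover have "fact (Suc a) / fact a = (of_nat (Suc a) :: rat)" by simp
    ultimately show "beta_weight (insert a (B - {Suc a})) = beta_weight B * (of_nat (Suc a) * u (Suc a))"
      by (simp only: mult.assoc)
  qed
  also have "\<dots> = (\<Sum>a\<in>Suc ` {a. Suc a \<in> B \<and> a \<notin> B}. beta_weight B * (of_nat a * u a))"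
    by (subst sum.reindex) auto
  also have "\<dots> = (\<Sum>a\<in>B. beta_weight B * (of_nat a * u a))"
  proof (rule sum.mono_neutral_left)
    \<comment> \<open>If \<open>a - 1\<close> is occupied, its factor in \<open>u a\<close> is zero;
      at \<open>a = 0\<close> the term vanishes because of the factor \<open>a\<close>.\<close>
    show "\<forall>a\<in>B - Suc ` {a. Suc a \<in> B \<and> a \<notin> B}. beta_weight B * (of_nat a * u a) = 0"
    proof
      fix a assume a: "a \<in> B - Suc ` {a. Suc a \<in> B \<and> a \<notin> B}"
      show "beta_weight B * (of_nat a * u a) = 0"
      proof (cases a)
        case (Suc c)
        with a have "c \<in> B - {a}" by auto
        then have "u a = 0" unfolding u_def e_def using assms(1) Suc by (intro prod_zero) (auto intro!: bexI[of _ c])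
        then show ?thesis by simp
      qed simp
    qed
  qed (use assms in auto)
  also have "\<dots> = beta_weight B * (\<Sum>a\<in>B. of_nat a * u a)" by (simp add: sum_distrib_left)
  finally have "2 * (\<Sum>a\<in>{a. Suc a \<in> B \<and> a \<notin> B}. beta_weight (insert a (B - {Suc a})))
      = beta_weight B * (2 * (\<Sum>a\<in>B. of_nat a * u a))" by simp
  then show ?thesis unfolding s .
qed

text \<open>The equation is doubled because \<open>N * (N - 1) / 2\<close> is not an expression in \<open>nat\<close>.\<close>

definition beta_sets :: "nat \<Rightarrow> nat \<Rightarrow> nat set set" where
  "beta_sets N n = {B. finite B \<and> card B = N \<and> 2 * \<Sum>B = 2 * n + N * (N - 1)}"

lemma finite_beta_sets: "finite (beta_sets N n)"
proof (rule finite_subset)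
  show "beta_sets N n \<subseteq> Pow {..2 * n + N * (N - 1)}"
  proof
    fix B assume B: "B \<in> beta_sets N n"
    have "a \<le> 2 * n + N * (N - 1)" if "a \<in> B" for a
      using member_le_sum[of a B "\<lambda>a. a"] that B by (simp add: beta_sets_def)
    then show "B \<in> Pow {..2 * n + N * (N - 1)}" by auto
  qed
qed simp

text \<open>The sum is least for an initial segment. This bound keeps \<open>n - Suc N\<close> from
  truncating in the recursion that follows.\<close>

lemma card_le_twice_sum:
  assumes "finite (B :: nat set)"
  shows "card B * (card B - 1) \<le> 2 * \<Sum>B"
  using assms
proof (induction B rule: finite_linorder_max_induct)
  case (insert b B)
  have "B \<subseteq> {..<b}" using insert by auto
  then have "card B \<le> b" using card_mono[of "{..<b}" B] by simp
  moreover have "b \<notin> B" using insert by auto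
  moreover have "Suc m * m = 2 * m + m * (m - 1)" for m by (cases m) auto
  ultimately show ?case using insert by simp
qed simp

text \<open>In terms of partitions with at most \<open>Suc N\<close> parts: either all these parts
  are positive and the first column is removed, or a zero part is dropped.\<close>

lemma beta_sets_Suc_cases:
  assumes "B \<in> beta_sets (Suc N) n"
  obtains C where "B = Suc ` C" "C \<in> beta_sets (Suc N) (n - Suc N)" "Suc N \<le> n"
  | C where "B = insert 0 (Suc ` C)" "C \<in> beta_sets N n"
proof -
  define C where "C = (\<lambda>b. b - 1) ` (B - {0})"
  have S: "Suc ` C = B - {0}"
  proof -
    have "Suc ` C = (\<lambda>b. b) ` (B - {0})"
      unfolding C_def image_image by (rule image_cong) auto
    then show ?thesis by simp
  qed
  have fin: "finite C" and cardB: "card B = Suc N" and sumB: "2 * \<Sum>B = 2 * n + Suc N * N"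
    using assms by (auto simp: C_def beta_sets_def)
  have c: "card C = card (B - {0})" "\<Sum>(B - {0}) = \<Sum>C + card C"
    unfolding S[symmetric] by (simp_all add: card_image sum.reindex sum.distrib sum_Suc)
  have s: "\<Sum>(B - {0}) = \<Sum>B"
    by (rule sum.mono_neutral_left) (use assms in \<open>auto simp: beta_sets_def\<close>)
  show ?thesis
  proof (cases "0 \<in> B")
    case True
    then have "card C = N" using c cardB by simp
    moreover have "Suc N * N = 2 * N + N * (N - 1)" by (cases N) auto
    ultimately have "C \<in> beta_sets N n"
      using fin c s sumB by (simp add: beta_sets_def)
    moreover have "B = insert 0 (Suc ` C)" using S True by auto
    ultimately show ?thesis using that(2) by blast
  next
    case False
    then have B: "B = Suc ` C" using S by auto
    have "card C = Suc N" using c cardB False by simp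
    moreover from this have "Suc N * N \<le> 2 * \<Sum>C" using card_le_twice_sum[OF fin] by simp
    ultimately have "Suc N \<le> n" "C \<in> beta_sets (Suc N) (n - Suc N)"
      using fin c s sumB by (auto simp: beta_sets_def)
    then show ?thesis using B that(1) by blast
  qed
qed

lemma beta_sets_SucI:
  assumes "C \<in> beta_sets N n"
  shows "insert 0 (Suc ` C) \<in> beta_sets (Suc N) n"
proof -
  have "Suc N * N = 2 * N + N * (N - 1)" by (cases N) auto
  then show ?thesis
    using assms by (auto simp: beta_sets_def card_insert_if card_image sum.reindex sum_Suc)
qed

lemma beta_sets_shiftI:
  assumes "C \<in> beta_sets N n"
  shows "Suc ` C \<in> beta_sets N (n + N)"
  using assms by (auto simp: beta_sets_def card_image sum.reindex sum_Suc)

lemma beta_sets_0: "beta_sets 0 n = (if n = 0 then {{}} else {})"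
  by (auto simp: beta_sets_def)

lemma beta_sets_Suc:
  "beta_sets (Suc N) n = (if Suc N \<le> n then image Suc ` beta_sets (Suc N) (n - Suc N) else {})
     \<union> (\<lambda>C. insert 0 (Suc ` C)) ` beta_sets N n"
    (is "_ = ?R")
proof (intro equalityI subsetI)
  fix B assume "B \<in> beta_sets (Suc N) n"
  then show "B \<in> ?R" by (cases rule: beta_sets_Suc_cases) auto
next
  fix B assume "B \<in> ?R"
  then consider C where "Suc N \<le> n" "B = Suc ` C" "C \<in> beta_sets (Suc N) (n - Suc N)"
    | C where "B = insert 0 (Suc ` C)" "C \<in> beta_sets N n"
    by (auto split: if_splits)
  then show "B \<in> beta_sets (Suc N) n"
  proof cases
    case (1 C)
    then show ?thesis using beta_sets_shiftI[of C "Suc N" "n - Suc N"] by simp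
  next
    case (2 C)
    then show ?thesis using beta_sets_SucI by simp
  qed
qed

lemma card_beta_sets_Suc:
  "card (beta_sets (Suc N) n)
   = (if Suc N \<le> n then card (beta_sets (Suc N) (n - Suc N)) else 0) + card (beta_sets N n)"
proof -
  have i1: "inj_on (image Suc) A" for A
    by (auto simp: inj_on_def inj_image_eq_iff)
  have i2: "inj_on (\<lambda>C. insert 0 (Suc ` C)) A" for A
  proof (rule inj_onI)
    fix C D assume "insert 0 (Suc ` C) = insert 0 (Suc ` D)"
    then have "insert 0 (Suc ` C) - {0} = insert 0 (Suc ` D) - {0}" by simp
    then have "Suc ` C = Suc ` D" by auto
    then show "C = D" by (simp add: inj_image_eq_iff)
  qed
  show ?thesis
    by (subst beta_sets_Suc, subst card_Un_disjoint) (auto simp: finite_beta_sets card_image[OF i1] card_image[OF i2])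
qed

text \<open>A partition of \<open>n\<close> has at most \<open>n\<close> parts, so
  \<open>card (beta_sets n n)\<close> is the number of partitions of \<open>n\<close>.\<close>

lemma card_beta_sets_stable: "n \<le> N \<Longrightarrow> card (beta_sets N n) = card (beta_sets n n)"
  by (induction N rule: dec_induct) (simp_all add: card_beta_sets_Suc)

lemma beta_sets_n_0: "beta_sets N 0 = {{..<N}}"
proof (induction N)
  case (Suc N)
  have "{..<Suc N} = insert 0 (Suc ` {..<N})" by (rule lessThan_Suc_eq_insert_0)
  then show ?case using Suc by (subst beta_sets_Suc) simp
qed (simp add: beta_sets_0)

text \<open>With fewer boxes than numbers some part is zero. This is the room that
  \<open>sum_beta_weight_up\<close> asks for.\<close>

lemma beta_sets_zero_mem:
  assumes "B \<in> beta_sets N n" "n < N"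
  shows "0 \<in> B"
proof -
  obtain M where "N = Suc M" using assms by (cases N) auto
  then show ?thesis using assms by (auto elim: beta_sets_Suc_cases)
qed

lemma beta_sets_move:
  assumes "finite B" "a \<in> B" "Suc a \<notin> B"
  shows "insert (Suc a) (B - {a}) \<in> beta_sets N (Suc n) \<longleftrightarrow> B \<in> beta_sets N n"
proof -
  have "card (insert (Suc a) (B - {a})) = card B"
    using assms card_Suc_Diff1[of B a] by simp
  moreover have "\<Sum>(insert (Suc a) (B - {a})) = Suc (\<Sum>B)"
    using assms by (simp add: sum.remove[of B a])
  ultimately show ?thesis using assms(1) by (simp add: beta_sets_def)
qed

text \<open>
  This is \<open>\<Sum> (f\<^sub>\<lambda>)\<^sup>2 = n!\<close> in terms of hook products: count the pairs of beta sets of levels \<open>n\<close> and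
  \<open>Suc n\<close> that differ by one move, weighted by the product of their weights, from both sides.
\<close>

lemma sum_beta_weight_square:
  assumes "n \<le> N"
  shows "(\<Sum>B\<in>beta_sets N n. (beta_weight B)\<^sup>2) = 1 / fact n"
  using assms
proof (induction n)
  case 0
  have "{(a, b). a \<in> {..<N} \<and> b \<notin> {..<N} \<and> b < a} = {}" by auto
  then have "beta_weight {..<N} = 1" unfolding beta_weight_def beta_pairs_def by (simp only: prod.empty)
  then show ?case by (simp add: beta_sets_n_0)
next
  case (Suc n)
  let ?U = "\<lambda>B. {a\<in>B. Suc a \<notin> B}" and ?D = "\<lambda>B. {a. Suc a \<in> B \<and> a \<notin> B}"
  have finU: "finite (?U B)" and finD: "finite (?D B)" if "finite B" for B :: "nat set"
  proof -
    show "finite (?U B)" using that by simp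
    have "?D B \<subseteq> (\<lambda>b. b - 1) ` B" by force
    then show "finite (?D B)" using that finite_subset by blast
  qed
  have fin: "finite B" if "B \<in> beta_sets N m" for B m using that by (simp add: beta_sets_def)
  have "of_nat (Suc n) * (\<Sum>B\<in>beta_sets N (Suc n). (beta_weight B)\<^sup>2)
      = (\<Sum>B\<in>beta_sets N (Suc n). of_nat (Suc n) * (beta_weight B)\<^sup>2)"
    by (rule sum_distrib_left)
  \<comment> \<open>Only one factor of the square is expanded by
    \<open>sum_beta_weight_down\<close>; the factor \<open>Suc n\<close> is absorbed there.\<close>
  also have "\<dots> = (\<Sum>B\<in>beta_sets N (Suc n). beta_weight B * (\<Sum>a\<in>?D B. beta_weight (insert a (B - {Suc a}))))"
  proof (rule sum.cong[OF refl])
    fix B assume B: "B \<in> beta_sets N (Suc n)"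
    then have "(2 * of_nat (\<Sum>B) :: rat) = of_nat (2 * Suc n + N * (N - 1))"
      unfolding beta_sets_def by (metis (mono_tags, lifting) mem_Collect_eq of_nat_mult of_nat_numeral)
    moreover have "of_nat (N * (N - 1)) = (of_nat N * (of_nat N - 1) :: rat)"
      by (cases N) (simp_all add: algebra_simps)
    ultimately have "2 * of_nat (\<Sum>B) - of_nat (card B) * (of_nat (card B) - 1) = (2 * of_nat (Suc n) :: rat)"
      using B by (simp only: of_nat_add of_nat_mult of_nat_numeral) (simp add: beta_sets_def)
    then have "2 * (\<Sum>a\<in>?D B. beta_weight (insert a (B - {Suc a}))) = beta_weight B * (2 * of_nat (Suc n))"
      using sum_beta_weight_down[OF fin[OF B]] by (simp only:)
    then have "(\<Sum>a\<in>?D B. beta_weight (insert a (B - {Suc a}))) = beta_weight B * of_nat (Suc n)"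
      by (simp del: of_nat_Suc)
    then show "of_nat (Suc n) * (beta_weight B)\<^sup>2 = beta_weight B * (\<Sum>a\<in>?D B. beta_weight (insert a (B - {Suc a})))"
      by (simp add: power2_eq_square)
  qed
  also have "\<dots> = (\<Sum>(B, a)\<in>(SIGMA B:beta_sets N (Suc n). ?D B). beta_weight B * beta_weight (insert a (B - {Suc a})))"
    unfolding sum_distrib_left
    by (rule sum.Sigma) (use finite_beta_sets fin finD in blast)+
  \<comment> \<open>The same moves are now indexed by their lower end.\<close>
  also have "\<dots> = (\<Sum>(B, a)\<in>(SIGMA B:beta_sets N n. ?U B). beta_weight B * beta_weight (insert (Suc a) (B - {a})))"
  proof (rule sum.reindex_bij_witness[of _ "\<lambda>(B, a). (insert (Suc a) (B - {a}), a)" "\<lambda>(B, a). (insert a (B - {Suc a}), a)"])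
    fix p assume "p \<in> (SIGMA B:beta_sets N (Suc n). ?D B)"
    then obtain B a where p: "p = (B, a)" and B: "B \<in> beta_sets N (Suc n)" "Suc a \<in> B" "a \<notin> B" by auto
    then have eq: "insert (Suc a) (insert a (B - {Suc a}) - {a}) = B" by auto
    then show "(case case p of (B, a) \<Rightarrow> (insert a (B - {Suc a}), a) of (B, a) \<Rightarrow> (insert (Suc a) (B - {a}), a)) = p"
      and "(case case p of (B, a) \<Rightarrow> (insert a (B - {Suc a}), a) of (B, a) \<Rightarrow> beta_weight B * beta_weight (insert (Suc a) (B - {a})))
        = (case p of (B, a) \<Rightarrow> beta_weight B * beta_weight (insert a (B - {Suc a})))"
      by (simp_all add: p)
    have "insert a (B - {Suc a}) \<in> beta_sets N n"
      using B beta_sets_move[of "insert a (B - {Suc a})" a N n] fin[OF B(1)] eq by simp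
    then show "(case p of (B, a) \<Rightarrow> (insert a (B - {Suc a}), a)) \<in> (SIGMA B:beta_sets N n. ?U B)"
      by (simp add: p)
  next
    fix p assume "p \<in> (SIGMA B:beta_sets N n. ?U B)"
    then obtain B a where p: "p = (B, a)" and B: "B \<in> beta_sets N n" "a \<in> B" "Suc a \<notin> B" by auto
    then have eq: "insert a (insert (Suc a) (B - {a}) - {Suc a}) = B" by auto
    then show "(case case p of (B, a) \<Rightarrow> (insert (Suc a) (B - {a}), a) of (B, a) \<Rightarrow> (insert a (B - {Suc a}), a)) = p"
      by (simp add: p)
    have "insert (Suc a) (B - {a}) \<in> beta_sets N (Suc n)"
      using B beta_sets_move[of B a N n] fin[OF B(1)] by simp
    then show "(case p of (B, a) \<Rightarrow> (insert (Suc a) (B - {a}), a)) \<in> (SIGMA B:beta_sets N (Suc n). ?D B)"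
      by (simp add: p)
  qed
  also have "\<dots> = (\<Sum>B\<in>beta_sets N n. beta_weight B * (\<Sum>a\<in>?U B. beta_weight (insert (Suc a) (B - {a}))))"
    unfolding sum_distrib_left
    by (rule sum.Sigma[symmetric]) (use finite_beta_sets fin finU in blast)+
  also have "\<dots> = (\<Sum>B\<in>beta_sets N n. (beta_weight B)\<^sup>2)"
  proof (rule sum.cong[OF refl])
    fix B assume B: "B \<in> beta_sets N n"
    then show "beta_weight B * (\<Sum>a\<in>?U B. beta_weight (insert (Suc a) (B - {a}))) = (beta_weight B)\<^sup>2"
      using sum_beta_weight_up[of B] beta_sets_zero_mem[OF B] fin Suc.prems by (simp add: power2_eq_square)
  qed
  also have "\<dots> = 1 / fact n" using Suc by simp
  finally have "(\<Sum>B\<in>beta_sets N (Suc n). (beta_weight B)\<^sup>2) = 1 / fact n / of_nat (Suc n)"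
    by (metis nonzero_mult_div_cancel_left of_nat_neq_0)
  then show ?case by (simp add: mult.commute)
qed

section \<open>Generating functions\<close>

definition finite_fibres :: "'a set \<Rightarrow> ('a \<Rightarrow> nat) \<Rightarrow> bool" where
  "finite_fibres A s \<longleftrightarrow> (\<forall>n. finite {a \<in> A. s a = n})"

text \<open>Only meaningful for finite fibres: a sum over an infinite fibre is 0.\<close>

definition gf :: "'a set \<Rightarrow> ('a \<Rightarrow> nat) \<Rightarrow> ('a \<Rightarrow> 'c::comm_ring_1) \<Rightarrow> 'c fps" where
  "gf A s w = Abs_fps (\<lambda>n. \<Sum>a\<in>{a \<in> A. s a = n}. w a)"

lemma gf_nth: "fps_nth (gf A s w) n = (\<Sum>a\<in>{a \<in> A. s a = n}. w a)"
  by (simp add: gf_def)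

text \<open>Convergence is coefficientwise, and coefficient \<open>n\<close> no longer changes once
  the finite index set contains the fibre over \<open>n\<close>.\<close>

lemma has_sum_gf:
  assumes "finite_fibres A s"
  shows "((\<lambda>a. fps_X ^ s a * fps_const (w a)) has_sum gf A s w) A"
  unfolding has_sum_def
proof (rule tendsto_fpsI)
  fix n
  have "fps_nth (\<Sum>a\<in>Y. fps_X ^ s a * fps_const (w a)) n = fps_nth (gf A s w) n"
    if Y: "finite Y" "{a \<in> A. s a = n} \<subseteq> Y" "Y \<subseteq> A" for Y
  proof -
    have "fps_nth (\<Sum>a\<in>Y. fps_X ^ s a * fps_const (w a)) n = (\<Sum>a\<in>Y. if s a = n then w a else 0)"
      by (auto simp: fps_sum_nth intro!: sum.cong)
    also have "\<dots> = (\<Sum>a\<in>{a \<in> Y. s a = n}. w a)"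
      using Y(1) by (simp add: sum.inter_filter)
    also have "{a \<in> Y. s a = n} = {a \<in> A. s a = n}" using Y by auto
    finally show ?thesis by (simp add: gf_nth)
  qed
  then show "\<forall>\<^sub>F Y in finite_subsets_at_top A.
      fps_nth (\<Sum>a\<in>Y. fps_X ^ s a * fps_const (w a)) n = fps_nth (gf A s w) n"
    unfolding eventually_finite_subsets_at_top
    using assms by (intro exI[of _ "{a \<in> A. s a = n}"]) (auto simp: finite_fibres_def)
qed

lemma gf_reindex:
  assumes h: "bij_betw h A B" and eq: "\<And>a. a \<in> A \<Longrightarrow> s' (h a) = s a" "\<And>a. a \<in> A \<Longrightarrow> w' (h a) = w a"
  shows "gf A s w = gf B s' w'"
proof (rule fps_ext)
  fix n
  have "bij_betw h {a \<in> A. s a = n} {b \<in> B. s' b = n}"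
    using h eq(1) by (auto simp: bij_betw_def inj_on_def image_iff)
  then have "(\<Sum>b\<in>{b \<in> B. s' b = n}. w' b) = (\<Sum>a\<in>{a \<in> A. s a = n}. w' (h a))"
    by (rule sum.reindex_bij_betw[symmetric])
  then show "fps_nth (gf A s w) n = fps_nth (gf B s' w') n"
    by (simp add: gf_nth eq(2))
qed

lemma finite_fibres_reindex:
  assumes "bij_betw h A B" "\<And>a. a \<in> A \<Longrightarrow> s' (h a) = s a" "finite_fibres B s'"
  shows "finite_fibres A s"
  unfolding finite_fibres_def
proof
  fix n
  have "inj_on h {a \<in> A. s a = n}" using assms(1) by (auto simp: bij_betw_def inj_on_def)
  moreover have "h ` {a \<in> A. s a = n} \<subseteq> {b \<in> B. s' b = n}"
    using assms(1,2) by (auto simp: bij_betw_def)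
  ultimately show "finite {a \<in> A. s a = n}"
    using assms(3) by (auto simp: finite_fibres_def intro: inj_on_finite)
qed

lemma
  assumes "finite_fibres A s" "finite_fibres B s'"
  shows finite_fibres_times: "finite_fibres (A \<times> B) (\<lambda>(a, b). s a + s' b)"
    and gf_times: "gf A s w * gf B s' w' = gf (A \<times> B) (\<lambda>(a, b). s a + s' b) (\<lambda>(a, b). w a * w' b)"
proof -
  let ?A = "\<lambda>i. {a \<in> A. s a = i}" and ?B = "\<lambda>i. {b \<in> B. s' b = i}"
  have U: "{p \<in> A \<times> B. (case p of (a, b) \<Rightarrow> s a + s' b) = n} = (\<Union>i\<in>{0..n}. ?A i \<times> ?B (n - i))" for n
    by auto
  have fin: "finite (?A i)" "finite (?B i)" for i using assms by (auto simp: finite_fibres_def)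
  show "finite_fibres (A \<times> B) (\<lambda>(a, b). s a + s' b)"
    unfolding finite_fibres_def U using fin by auto
  show "gf A s w * gf B s' w' = gf (A \<times> B) (\<lambda>(a, b). s a + s' b) (\<lambda>(a, b). w a * w' b)"
  proof (rule fps_ext)
    fix n
    have "fps_nth (gf (A \<times> B) (\<lambda>(a, b). s a + s' b) (\<lambda>(a, b). w a * w' b)) n
        = (\<Sum>i\<in>{0..n}. \<Sum>(a, b)\<in>?A i \<times> ?B (n - i). w a * w' b)"
      unfolding gf_nth U
      by (rule sum.UNION_disjoint) (use fin in auto)
    also have "\<dots> = fps_nth (gf A s w * gf B s' w') n"
      by (simp add: fps_mult_nth gf_nth sum_product sum.cartesian_product)
    finally show "fps_nth (gf A s w * gf B s' w') n
        = fps_nth (gf (A \<times> B) (\<lambda>(a, b). s a + s' b) (\<lambda>(a, b). w a * w' b)) n" by simp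
  qed
qed

lemma gf_group:
  assumes "finite_fibres A s" "finite_fibres B s'" "\<And>a. a \<in> A \<Longrightarrow> h a \<in> B" "\<And>a. a \<in> A \<Longrightarrow> s' (h a) = s a"
  shows "gf A s w = gf B s' (\<lambda>b. \<Sum>a\<in>{a \<in> A. h a = b}. w a)"
proof (rule fps_ext)
  fix n
  have "(\<Sum>b\<in>{b \<in> B. s' b = n}. \<Sum>a\<in>{a \<in> A. h a = b}. w a)
      = (\<Sum>b\<in>{b \<in> B. s' b = n}. \<Sum>a\<in>{a \<in> {a \<in> A. s a = n}. h a = b}. w a)"
    using assms(4) by (intro sum.cong refl) auto
  also have "\<dots> = (\<Sum>a\<in>{a \<in> A. s a = n}. w a)"
    by (rule sum.group) (use assms in \<open>auto simp: finite_fibres_def\<close>)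
  finally show "fps_nth (gf A s w) n = fps_nth (gf B s' (\<lambda>b. \<Sum>a\<in>{a \<in> A. h a = b}. w a)) n"
    by (simp add: gf_nth)
qed

text \<open>Both conclusions share one induction, because \<open>gf_times\<close> needs the finite
  fibres of the remaining product.\<close>

lemma gf_PiE_finite_fibres_PiE:
  assumes "finite I" "\<And>i. i \<in> I \<Longrightarrow> finite_fibres (A i) (s i)"
  shows "finite_fibres (Pi\<^sub>E I A) (\<lambda>f. \<Sum>i\<in>I. s i (f i)) \<and>
    gf (Pi\<^sub>E I A) (\<lambda>f. \<Sum>i\<in>I. s i (f i)) (\<lambda>f. \<Prod>i\<in>I. w i (f i)) = (\<Prod>i\<in>I. gf (A i) (s i) (w i))"
  using assms
proof (induction I rule: finite_induct)
  case empty
  then show ?case by (auto simp: finite_fibres_def fps_eq_iff gf_nth)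
next
  case (insert i I)
  let ?h = "\<lambda>(y, g). g(i := y)"
  have bij: "bij_betw ?h (A i \<times> Pi\<^sub>E I A) (Pi\<^sub>E (insert i I) A)"
    using inj_combinator[OF insert.hyps(2), of A] unfolding PiE_insert_eq by (simp add: bij_betw_def)
  let ?S = "\<lambda>I f. \<Sum>i\<in>I. s i (f i)" and ?W = "\<lambda>I f. \<Prod>i\<in>I. w i (f i)"
  have "?S I (g(i := y)) = ?S I g" "?W I (g(i := y)) = ?W I g" for g y
    using insert.hyps by (auto intro!: sum.cong prod.cong)
  then have upd: "?S (insert i I) (?h p) = (case p of (y, g) \<Rightarrow> s i y + ?S I g)"
    "?W (insert i I) (?h p) = (case p of (y, g) \<Rightarrow> w i y * ?W I g)" for p
    using insert.hyps by (simp_all split: prod.split)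
  have IH: "finite_fibres (Pi\<^sub>E I A) (?S I)" "gf (Pi\<^sub>E I A) (?S I) (?W I) = (\<Prod>i\<in>I. gf (A i) (s i) (w i))"
    using insert by auto
  have fi: "finite_fibres (A i) (s i)" using insert by auto
  have "gf (Pi\<^sub>E (insert i I) A) (?S (insert i I)) (?W (insert i I)) = gf (A i) (s i) (w i) * gf (Pi\<^sub>E I A) (?S I) (?W I)"
    unfolding gf_times[OF fi IH(1)] using upd by (intro gf_reindex[OF bij, symmetric]) auto
  moreover have "finite_fibres (Pi\<^sub>E (insert i I) A) (?S (insert i I))"
  proof -
    \<comment> \<open>\<open>finite_fibres_reindex\<close> pulls finiteness back from the target of
      a bijection, so \<open>?h\<close> has to be inverted.\<close>
    define k where "k = inv_into (A i \<times> Pi\<^sub>E I A) ?h"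
    have k: "bij_betw k (Pi\<^sub>E (insert i I) A) (A i \<times> Pi\<^sub>E I A)"
      unfolding k_def by (rule bij_betw_inv_into[OF bij])
    show ?thesis
    proof (rule finite_fibres_reindex[OF k _ finite_fibres_times[OF fi IH(1)]])
      fix f assume "f \<in> Pi\<^sub>E (insert i I) A"
      then have "?h (k f) = f" unfolding k_def using bij by (metis bij_betw_inv_into_right)
      then show "(case k f of (a, b) \<Rightarrow> s i a + ?S I b) = ?S (insert i I) f"
        using upd(1)[of "k f"] by simp
    qed
  qed
  ultimately show ?case using insert.hyps IH(2) by simp
qed

lemmas finite_fibres_PiE = gf_PiE_finite_fibres_PiE[THEN conjunct1]
lemmas gf_PiE = gf_PiE_finite_fibres_PiE[THEN conjunct2]

lemma finite_fibres_mult: "m > 0 \<Longrightarrow> finite_fibres (UNIV :: nat set) (\<lambda>n. m * n)"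
  unfolding finite_fibres_def
proof
  fix n assume "m > 0"
  then have "{k \<in> UNIV. m * k = n} \<subseteq> {..n}" by auto
  then show "finite {k \<in> UNIV. m * k = n}" by (rule finite_subset) simp
qed

lemma gf_mult_nth:
  assumes "m > 0"
  shows "fps_nth (gf UNIV (\<lambda>n. m * n) w) k = (if m dvd k then w (k div m) else 0)"
proof -
  have "{n \<in> UNIV. m * n = k} = (if m dvd k then {k div m} else {})"
    using assms by auto
  then show ?thesis by (simp add: gf_nth)
qed

section \<open>Infinite products as generating functions\<close>

text \<open>Factors from index \<open>N\<close> on differ from 1 by a multiple of
  \<open>q ^ j\<close> with \<open>j > k\<close>, so they cannot affect coefficient
  \<open>k\<close>.\<close>

lemma qpoch_inf_nth:
  fixes a q :: "'c::comm_ring_1 fps"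
  assumes a: "fps_nth a 0 = 0" and q: "fps_nth q 0 = 0" and "k < N"
  shows "fps_nth (qpoch_inf a q) k = fps_nth (\<Prod>j<N. 1 - a * q ^ j) k"
proof -
  define P where "P N = (\<Prod>j<N. 1 - a * q ^ j)" for N
  have step: "fps_nth (P (Suc n)) k = fps_nth (P n) k" if "k < n" for n
  proof -
    have "fps_nth (P n * a * q ^ n) k = 0"
      unfolding fps_mult_nth[of "P n * a"]
      by (rule sum.neutral) (use that startsby_zero_power_prefix[OF q, of n] in auto)
    moreover have "P (Suc n) = P n - P n * a * q ^ n"
      by (simp add: P_def algebra_simps)
    ultimately show ?thesis by simp
  qed
  have stable: "fps_nth (P M) k = fps_nth (P N) k" if "M \<ge> N" for M
    using that by (induction M rule: dec_induct) (use step \<open>k < N\<close> in simp_all)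
  \<comment> \<open>The predicate \<open>has_prod\<close> tolerates zero factors; excluding them
    leaves the limit of the plain partial products.\<close>
  have ne: "1 - a * q ^ j \<noteq> 0" for j
  proof
    assume "1 - a * q ^ j = 0"
    then have "fps_nth (1 - a * q ^ j) 0 = 0" by simp
    then show False using a by simp
  qed
  then have "(\<lambda>n. \<Prod>j\<le>n. 1 - a * q ^ j) \<longlonglongrightarrow> qpoch_inf a q"
    using has_prod_qpoch_inf[OF a q] by (auto simp: has_prod_def raw_has_prod_def)
  then have "\<forall>\<^sub>F n in sequentially. fps_nth (\<Prod>j\<le>n. 1 - a * q ^ j) k = fps_nth (qpoch_inf a q) k"
    unfolding tendsto_fps_iff by blast
  then obtain n0 where "\<And>n. n \<ge> n0 \<Longrightarrow> fps_nth (\<Prod>j\<le>n. 1 - a * q ^ j) k = fps_nth (qpoch_inf a q) k"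
    by (auto simp: eventually_sequentially)
  from this[of "max n0 N"] have "fps_nth (P (Suc (max n0 N))) k = fps_nth (qpoch_inf a q) k"
    by (simp add: P_def lessThan_Suc_atMost)
  then show ?thesis using stable[of "Suc (max n0 N)"] by (simp add: P_def)
qed

text \<open>Expanding the product selects a finite set \<open>D\<close> of indices at which the
  second summand of the factor is taken. An index \<open>d\<close> adds at least \<open>d\<close> to
  the exponent, which bounds \<open>D\<close>.\<close>

lemma
  fixes v :: "'c::comm_ring_1"
  assumes "m > 0" "c > 0"
  shows finite_fibres_finite_sets: "finite_fibres {D. finite D} (\<lambda>D. \<Sum>d\<in>D. m * d + c)"
    and gf_finite_sets: "gf {D. finite D} (\<lambda>D. \<Sum>d\<in>D. m * d + c) (\<lambda>D. v ^ card D)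
      = qpoch_inf (- (fps_const v * fps_X ^ c)) (fps_X ^ m)"
proof -
  have sub: "{D \<in> {D. finite D}. (\<Sum>d\<in>D. m * d + c) = k} \<subseteq> Pow {..<Suc k}" for k
  proof safe
    fix D d assume D: "finite D" "k = (\<Sum>d\<in>D. m * d + c)" "d \<in> D"
    have "d \<le> m * d + c" using assms by (cases m) auto
    also have "\<dots> \<le> (\<Sum>d\<in>D. m * d + c)"
      using member_le_sum[of d D "\<lambda>d. m * d + c"] D by simp
    finally show "d < Suc (\<Sum>d\<in>D. m * d + c)" by simp
  qed
  show "finite_fibres {D. finite D} (\<lambda>D. \<Sum>d\<in>D. m * d + c)"
    unfolding finite_fibres_def using sub by (meson finite_Pow_iff finite_lessThan finite_subset)
  show "gf {D. finite D} (\<lambda>D. \<Sum>d\<in>D. m * d + c) (\<lambda>D. v ^ card D)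
      = qpoch_inf (- (fps_const v * fps_X ^ c)) (fps_X ^ m)"
  proof (rule fps_ext)
    fix k
    have "fps_nth (qpoch_inf (- (fps_const v * fps_X ^ c)) (fps_X ^ m)) k
        = fps_nth (\<Prod>j<Suc k. 1 - (- (fps_const v * fps_X ^ c)) * (fps_X ^ m) ^ j) k"
      by (rule qpoch_inf_nth) (use assms in auto)
    also have "(\<Prod>j<Suc k. 1 - (- (fps_const v * fps_X ^ c)) * (fps_X ^ m) ^ j)
        = (\<Prod>j<Suc k. fps_const v * fps_X ^ (m * j + c) + 1)"
      by (intro prod.cong refl) (simp add: power_mult[symmetric] power_add algebra_simps)
    also have "\<dots> = (\<Sum>D\<in>Pow {..<Suc k}. \<Prod>j\<in>D. fps_const v * fps_X ^ (m * j + c))"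
      by (subst prod_add) auto
    also have "\<dots> = (\<Sum>D\<in>Pow {..<Suc k}. fps_const (v ^ card D) * fps_X ^ (\<Sum>j\<in>D. m * j + c))"
      by (simp add: prod.distrib power_sum fps_const_power)
    also have "fps_nth \<dots> k = (\<Sum>D\<in>Pow {..<Suc k}. if (\<Sum>j\<in>D. m * j + c) = k then v ^ card D else 0)"
      by (auto simp: fps_sum_nth intro!: sum.cong)
    also have "\<dots> = (\<Sum>D\<in>{D \<in> Pow {..<Suc k}. (\<Sum>j\<in>D. m * j + c) = k}. v ^ card D)"
      by (rule sum.inter_filter[symmetric]) simp
    also have "{D \<in> Pow {..<Suc k}. (\<Sum>j\<in>D. m * j + c) = k} = {D \<in> {D. finite D}. (\<Sum>j\<in>D. m * j + c) = k}"
      using sub[of k] by (auto intro: finite_subset)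
    finally show "fps_nth (gf {D. finite D} (\<lambda>D. \<Sum>d\<in>D. m * d + c) (\<lambda>D. v ^ card D)) k
        = fps_nth (qpoch_inf (- (fps_const v * fps_X ^ c)) (fps_X ^ m)) k" by (simp add: gf_nth)
  qed
qed

section \<open>Scalars, powers of \<open>b\<close> and exponential series over the coefficient
  ring\<close>

lemma scalar_mult: "scalar a * scalar b = scalar (a * b)"
  by (simp add: scalar_def mult_single)

lemma scalar_1 [simp]: "scalar 1 = 1"
  by (simp add: scalar_def flip: zero_prod_def)

lemma scalar_add: "scalar a + scalar b = scalar (a + b)"
  by (simp add: scalar_def single_add)

lemma scalar_0 [simp]: "scalar 0 = 0"
  by (simp add: scalar_def)

lemma scalar_of_nat: "scalar (of_nat n) = of_nat n"
  by (induction n) (simp_all add: scalar_add[symmetric])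

lemma scalar_power: "scalar a ^ n = scalar (a ^ n)"
  by (induction n) (simp_all add: scalar_mult)

lemma scalar_prod: "scalar (\<Prod>i\<in>A. f i) = (\<Prod>i\<in>A. scalar (f i))"
  by (induction A rule: infinite_finite_induct) (simp_all add: scalar_mult[symmetric])

lemma scalar_sum: "scalar (\<Sum>i\<in>A. f i) = (\<Sum>i\<in>A. scalar (f i))"
  by (induction A rule: infinite_finite_induct) (simp_all add: scalar_add[symmetric])

lemma b_pow_add: "b_pow (i + j) = b_pow i * b_pow j"
  by (simp add: b_pow_def mult_single)

lemma b_pow_0 [simp]: "b_pow 0 = 1"
  by (simp add: b_pow_def flip: zero_prod_def)

lemma b_pow_sum: "b_pow (\<Sum>i\<in>A. f i) = (\<Prod>i\<in>A. b_pow (f i))"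
  by (induction A rule: infinite_finite_induct) (simp_all add: b_pow_add)

lemma b_pow_power: "b_pow i ^ n = b_pow (int n * i)"
  by (induction n) (simp_all add: b_pow_add[symmetric] algebra_simps)

text \<open>The exponential of \<open>v X^m\<close>, written as a generating function so that
  products can be regrouped by \<open>gf_times\<close> and \<open>gf_group\<close>.\<close>

definition exp_gf :: "nat \<Rightarrow> coeff_ring \<Rightarrow> coeff_ring fps" where
  "exp_gf m v = gf UNIV (\<lambda>n. m * n) (\<lambda>n. scalar (1 / fact n) * v ^ n)"

lemma exp_series_eq:
  assumes "m > 0"
  shows "exp_series (fps_const v * fps_X ^ m) = exp_gf m v"
proof (rule fps_ext)
  fix k
  have "fps_nth (exp_series (fps_const v * fps_X ^ m)) k
      = (\<Sum>i=0..k. if m * i = k then scalar (1 / fact i) * v ^ i else 0)"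
    unfolding exp_series_def fps_compose_nth
    by (rule sum.cong) (auto simp: power_mult_distrib fps_const_power simp flip: power_mult)
  also have "\<dots> = (\<Sum>i\<in>{i \<in> {0..k}. m * i = k}. scalar (1 / fact i) * v ^ i)"
    by (rule sum.inter_filter[symmetric]) simp
  also have "{i \<in> {0..k}. m * i = k} = {i \<in> UNIV. m * i = k}" using assms by auto
  finally show "fps_nth (exp_series (fps_const v * fps_X ^ m)) k = fps_nth (exp_gf m v) k"
    by (simp add: exp_gf_def gf_nth)
qed

text \<open>Pairs are grouped by \<open>i + j\<close> and summed by the binomial theorem; the
  division by factorials takes place inside \<open>scalar\<close>.\<close>

lemma exp_gf_add:
  assumes m: "m > 0"
  shows "exp_gf m v * exp_gf m w = exp_gf m (v + w)"
proof -
  let ?c = "\<lambda>n. scalar (1 / fact n)"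
  let ?s = "\<lambda>(i, j). m * i + m * j" and ?w = "\<lambda>(i, j). (?c i * v ^ i) * (?c j * w ^ j)"
  have "exp_gf m v * exp_gf m w = gf (UNIV \<times> UNIV) ?s ?w"
    unfolding exp_gf_def by (rule gf_times) (use finite_fibres_mult[OF m] in auto)
  also have "\<dots> = gf UNIV (\<lambda>n. m * n) (\<lambda>n. \<Sum>p\<in>{p \<in> UNIV \<times> UNIV. (case p of (i, j) \<Rightarrow> i + j) = n}. ?w p)"
    by (rule gf_group) (use finite_fibres_mult[OF m] finite_fibres_times[OF finite_fibres_mult[OF m] finite_fibres_mult[OF m]] in \<open>auto simp: algebra_simps\<close>)
  also have "(\<lambda>n. \<Sum>p\<in>{p \<in> UNIV \<times> UNIV. (case p of (i, j) \<Rightarrow> i + j) = n}. ?w p) = (\<lambda>n. ?c n * (v + w) ^ n)"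
  proof
    fix n
    have "(\<Sum>p\<in>{p \<in> UNIV \<times> UNIV. (case p of (i, j) \<Rightarrow> i + j) = n}. ?w p)
        = (\<Sum>k\<le>n. (?c k * v ^ k) * (?c (n - k) * w ^ (n - k)))"
      by (rule sum.reindex_bij_witness[of _ "\<lambda>k. (k, n - k)" fst]) auto
    also have "\<dots> = (\<Sum>k\<le>n. ?c n * (of_nat (n choose k) * v ^ k * w ^ (n - k)))"
    proof (rule sum.cong[OF refl])
      fix k assume "k \<in> {..n}"
      then have "1 / fact k * (1 / fact (n - k)) = 1 / fact n * (of_nat (n choose k) :: rat)"
        by (simp add: binomial_fact)
      then have "?c k * ?c (n - k) = ?c n * of_nat (n choose k)"
        by (simp only: scalar_mult scalar_of_nat[symmetric])
      then have "(?c k * ?c (n - k)) * (v ^ k * w ^ (n - k)) = (?c n * of_nat (n choose k)) * (v ^ k * w ^ (n - k))"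
        by simp
      then show "(?c k * v ^ k) * (?c (n - k) * w ^ (n - k)) = ?c n * (of_nat (n choose k) * v ^ k * w ^ (n - k))"
        by (simp only: ac_simps)
    qed
    also have "\<dots> = ?c n * (v + w) ^ n"
      by (simp add: binomial_ring sum_distrib_left)
    finally show "(\<Sum>p\<in>{p \<in> UNIV \<times> UNIV. (case p of (i, j) \<Rightarrow> i + j) = n}. ?w p) = ?c n * (v + w) ^ n" .
  qed
  finally show ?thesis by (simp add: exp_gf_def)
qed

lemma exp_gf_0: "m > 0 \<Longrightarrow> exp_gf m 0 = 1"
  by (auto simp: fps_eq_iff exp_gf_def gf_mult_nth power_0_left dvd_div_eq_0_iff)

lemma exp_gf_power: "m > 0 \<Longrightarrow> exp_gf m v ^ k = exp_gf m (of_nat k * v)"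
  by (induction k) (simp_all add: exp_gf_0 exp_gf_add algebra_simps)

text \<open>Euler's product for partitions. With \<open>P N\<close> counting at most
  \<open>N\<close> parts, the recursion \<open>card_beta_sets_Suc\<close> peels off one factor at a
  time. Coefficients up to \<open>k\<close> only need \<open>N = Suc k\<close>.\<close>

lemma gf_beta_sets:
  assumes m: "m > 0"
  shows "gf UNIV (\<lambda>n. m * n) (\<lambda>n. of_nat (card (beta_sets n n))) * qpoch_inf (fps_X ^ m) (fps_X ^ m)
    = (1 :: 'c::comm_ring_1 fps)"
proof (rule fps_ext)
  fix k
  define P :: "nat \<Rightarrow> 'c fps" where "P N = gf UNIV (\<lambda>n. m * n) (\<lambda>n. of_nat (card (beta_sets N n)))" for N
  have P0: "P 0 = 1"
    using m by (auto simp: fps_eq_iff P_def gf_mult_nth beta_sets_0 dvd_div_eq_0_iff)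
  have rec: "P (Suc N) * (1 - fps_X ^ m * (fps_X ^ m) ^ N) = P N" for N
  proof -
    have "P (Suc N) = fps_X ^ (m * Suc N) * P (Suc N) + P N"
    proof (rule fps_ext)
      fix i
      have lt: "m * n < m * Suc N \<longleftrightarrow> \<not> Suc N \<le> n" for n
        using m by (simp only: mult_less_cancel1 not_le) simp
      have df: "m * n - m * Suc N = m * (n - Suc N)" for n
        by (simp only: diff_mult_distrib2)
      show "fps_nth (P (Suc N)) i = fps_nth (fps_X ^ (m * Suc N) * P (Suc N) + P N) i"
      proof (cases "m dvd i")
        case True
        then obtain n where "i = m * n" by auto
        then show ?thesis
          unfolding fps_add_nth fps_X_power_mult_nth P_def gf_mult_nth[OF m] lt df
          using m by (simp add: lt df card_beta_sets_Suc[of N] del: mult_Suc_right)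
      next
        case False
        then have "\<not> m dvd i - m * Suc N" if "\<not> i < m * Suc N"
          using that dvd_diffD1[of m i "m * Suc N"] dvd_diffD[of m i "m * Suc N"] by (auto simp del: mult_Suc_right)
        with False show ?thesis
          unfolding fps_add_nth fps_X_power_mult_nth P_def gf_mult_nth[OF m]
          by (simp del: mult_Suc_right)
      qed
    qed
    then have "P (Suc N) - fps_X ^ (m * Suc N) * P (Suc N) = P N"
      by (metis add_diff_cancel_left')
    moreover have "fps_X ^ (m * Suc N) = (fps_X ^ m * (fps_X ^ m) ^ N :: 'c fps)"
      by (simp only: mult_Suc_right power_add power_mult)
    ultimately show ?thesis
      by (simp only: right_diff_distrib mult_1_right mult_1_left mult.commute)
  qed
  have prod: "P N * (\<Prod>j<N. 1 - fps_X ^ m * (fps_X ^ m) ^ j) = 1" for N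
  proof (induction N)
    case (Suc N)
    have "P (Suc N) * (\<Prod>j<Suc N. 1 - fps_X ^ m * (fps_X ^ m) ^ j)
        = (P (Suc N) * (1 - fps_X ^ m * (fps_X ^ m) ^ N)) * (\<Prod>j<N. 1 - fps_X ^ m * (fps_X ^ m) ^ j)"
      by (simp add: mult_ac)
    then show ?case unfolding rec Suc .
  qed (simp add: P0)
  let ?G = "gf UNIV (\<lambda>n. m * n) (\<lambda>n. of_nat (card (beta_sets n n))) :: 'c fps"
  have "fps_nth ?G i = fps_nth (P (Suc k)) i" if "i \<le> k" for i
    unfolding P_def gf_mult_nth[OF m]
    using that card_beta_sets_stable[of "i div m" "Suc k"] div_le_dividend[of i m] by simp
  then have "fps_nth (?G * qpoch_inf (fps_X ^ m) (fps_X ^ m)) k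
      = fps_nth (P (Suc k) * (\<Prod>j<Suc k. 1 - fps_X ^ m * (fps_X ^ m) ^ j)) k"
    unfolding fps_mult_nth
    by (intro sum.cong refl arg_cong2[of _ _ _ _ "(*)"] qpoch_inf_nth) (use m in auto)
  then show "fps_nth (?G * qpoch_inf (fps_X ^ m) (fps_X ^ m)) k = fps_nth 1 k"
    unfolding prod .
qed

section \<open>Maya diagrams\<close>

text \<open>
  A Maya diagram is a set of integers that contains all sufficiently small and no sufficiently large
  integers. It encodes a partition, whose hooks are the pairs in \<open>hook_pairs\<close>, together with a charge.
\<close>

definition maya :: "int set \<Rightarrow> bool" where
  "maya M \<longleftrightarrow> (\<exists>L. {..<L} \<subseteq> M \<and> finite (M \<inter> {L..}))"

text \<open>\<open>B\<close> is what is seen from \<open>L\<close> upwards. The same diagram has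
  many such windows: lowering \<open>L\<close> adds zero parts to the partition that
  \<open>B\<close> encodes.\<close>

definition maya_of :: "int \<Rightarrow> nat set \<Rightarrow> int set" where
  "maya_of L B = {..<L} \<union> (\<lambda>b. L + int b) ` B"

text \<open>The sum over \<open>M\<close> normalised so that it vanishes for the ground state \<open>{..<0}\<close>.\<close>

definition normal_sum :: "(int \<Rightarrow> int) \<Rightarrow> int set \<Rightarrow> int" where
  "normal_sum f M = (\<Sum>m\<in>M \<inter> {0..}. f m) - (\<Sum>m\<in>{..<0} - M. f m)"

definition charge :: "int set \<Rightarrow> int" where
  "charge M = normal_sum (\<lambda>_. 1) M"

definition hook_pairs :: "int set \<Rightarrow> (int \<times> int) set" where
  "hook_pairs M = {(a, b). a \<in> M \<and> b \<notin> M \<and> b < a}"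

lemma maya_of_iff: "L + int b \<in> maya_of L B \<longleftrightarrow> b \<in> B"
  by (auto simp: maya_of_def)

lemma maya_of_inter: "maya_of L B \<inter> {L..} = (\<lambda>b. L + int b) ` B"
  by (auto simp: maya_of_def)

lemma inj_on_shift: "inj_on (\<lambda>b. L + int b) B"
  by (simp add: inj_on_def)

lemma maya_maya_of: "finite B \<Longrightarrow> maya (maya_of L B)"
  unfolding maya_def
  by (intro exI[of _ L]) (auto simp: maya_of_inter, auto simp: maya_of_def)

lemma maya_finite:
  assumes "maya M"
  shows "finite (M \<inter> {K..})" "finite ({..<K} - M)"
proof -
  obtain L where L: "{..<L} \<subseteq> M" "finite (M \<inter> {L..})" using assms by (auto simp: maya_def)
  have "M \<inter> {K..} \<subseteq> {K..<L} \<union> (M \<inter> {L..})" by auto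
  then show "finite (M \<inter> {K..})" using L(2) finite_subset by blast
  have "{..<K} - M \<subseteq> {L..<K}" using L(1) by (auto simp: not_less[symmetric])
  then show "finite ({..<K} - M)" using finite_subset by blast
qed

lemma maya_of_window:
  assumes "maya M" "{..<L} \<subseteq> M"
  obtains B where "finite B" "M = maya_of L B"
proof
  let ?B = "{b. L + int b \<in> M}"
  have "(\<lambda>b. L + int b) ` ?B \<subseteq> M \<inter> {L..}" by auto
  then have "finite ((\<lambda>b. L + int b) ` ?B)" using maya_finite[OF assms(1)] finite_subset by blast
  then show "finite ?B" by (simp add: finite_image_iff inj_on_shift)
  have "m \<in> maya_of L ?B" if "m \<in> M" for m
  proof (cases "m < L")
    case False
    then have "m = L + int (nat (m - L))" by simp
    then show ?thesis using that by (metis (mono_tags) maya_of_iff mem_Collect_eq)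
  qed (simp add: maya_of_def)
  then show "M = maya_of L ?B" using assms(2) by (auto simp: maya_of_def)
qed

lemma maya_cases:
  assumes "maya M"
  obtains L B where "L \<le> K" "finite B" "M = maya_of L B"
proof -
  obtain L where "{..<L} \<subseteq> M" using assms by (auto simp: maya_def)
  then have "{..<min L K} \<subseteq> M" by auto
  then show ?thesis using maya_of_window[OF assms] that[of "min L K"] by (metis min.cobounded2)
qed

lemma normal_sum_maya_of:
  assumes "finite B" "L \<le> 0"
  shows "normal_sum f (maya_of L B) = (\<Sum>b\<in>B. f (L + int b)) - (\<Sum>m\<in>{L..<0}. f m)"
proof -
  let ?M = "maya_of L B"
  have "?M \<inter> {L..} = (?M \<inter> {0..}) \<union> (?M \<inter> {L..<0})" using assms by auto
  then have "(\<Sum>m\<in>?M \<inter> {L..}. f m) = (\<Sum>m\<in>?M \<inter> {0..}. f m) + (\<Sum>m\<in>?M \<inter> {L..<0}. f m)"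
    using maya_finite(1)[OF maya_maya_of[OF assms(1)]] by (simp only:) (rule sum.union_disjoint; auto)
  moreover have "(\<Sum>m\<in>{L..<0}. f m) = (\<Sum>m\<in>?M \<inter> {L..<0}. f m) + (\<Sum>m\<in>{L..<0} - ?M. f m)"
    using sum.Int_Diff[of "{L..<0}" f ?M] by (simp add: Int_commute)
  moreover have "{..<0} - ?M = {L..<0} - ?M" by (auto simp: maya_of_def)
  moreover have "(\<Sum>m\<in>?M \<inter> {L..}. f m) = (\<Sum>b\<in>B. f (L + int b))"
    unfolding maya_of_inter by (simp add: sum.reindex[OF inj_on_shift])
  ultimately show ?thesis by (simp add: normal_sum_def)
qed

lemma normal_sum_linear:
  "normal_sum (\<lambda>m. c * f m + d * g m) M = c * normal_sum f M + d * normal_sum g M"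
  by (simp add: normal_sum_def sum.distrib sum_distrib_left algebra_simps)

lemma charge_maya_of:
  assumes "finite B"
  shows "charge (maya_of L B) = L + int (card B)"
proof (cases "L \<le> 0")
  case True
  then show ?thesis using assms by (simp add: charge_def normal_sum_maya_of)
next
  \<comment> \<open>Windows above 0 do occur: \<open>bij_betw_maya_of\<close> uses
    \<open>L = c - int n\<close>.\<close>
  case False
  then have "maya_of L B \<inter> {0..} = {0..<L} \<union> (\<lambda>b. L + int b) ` B" "{..<0} - maya_of L B = {}"
    by (auto simp: maya_of_def)
  moreover have "card ({0..<L} \<union> (\<lambda>b. L + int b) ` B) = nat L + card B"
    using assms by (subst card_Un_disjoint) (auto simp: card_image inj_on_shift)
  ultimately show ?thesis using False unfolding charge_def normal_sum_def by (simp only:) simp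
qed

lemma finite_beta_pairs: "finite B \<Longrightarrow> finite (beta_pairs B)"
  by (rule finite_subset[of _ "SIGMA a:B. {..<a}"]) (auto simp: beta_pairs_def)

lemma hook_pairs_maya_of:
  "hook_pairs (maya_of L B) = (\<lambda>(a, b). (L + int a, L + int b)) ` beta_pairs B"
proof (intro equalityI subsetI)
  fix p assume "p \<in> hook_pairs (maya_of L B)"
  then obtain a b where p: "p = (a, b)" "a \<in> maya_of L B" "b \<notin> maya_of L B" "b < a"
    by (auto simp: hook_pairs_def)
  moreover from this have "L \<le> b" by (auto simp: maya_of_def)
  ultimately have "(nat (a - L), nat (b - L)) \<in> beta_pairs B"
    using maya_of_iff[of L "nat (a - L)" B] maya_of_iff[of L "nat (b - L)" B]
    by (simp add: beta_pairs_def)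
  then show "p \<in> (\<lambda>(a, b). (L + int a, L + int b)) ` beta_pairs B"
    using p \<open>L \<le> b\<close> by (intro image_eqI[of _ _ "(nat (a - L), nat (b - L))"]) auto
qed (auto simp: hook_pairs_def beta_pairs_def maya_of_iff)

lemma inj_on_shift2: "inj_on (\<lambda>(a, b). (L + int a, L + int b)) P"
  by (auto simp: inj_on_def)

text \<open>Each \<open>a\<close> exceeds exactly \<open>a\<close> natural numbers, so the sum of
  \<open>B\<close> counts the pairs \<open>b < a\<close> with \<open>a\<close> in \<open>B\<close>.
  Those with \<open>b\<close> in \<open>B\<close> are the two-element subsets of \<open>B\<close>,
  the others are the boxes.\<close>

lemma card_beta_pairs:
  assumes "finite B"
  shows "2 * card (beta_pairs B) + card B * (card B - 1) = 2 * \<Sum>B"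
proof -
  have "2 * (\<Sum>a\<in>B. card ({..<a} \<inter> B)) = card B * (card B - 1)"
    using assms
  proof (induction B rule: finite_linorder_max_induct)
    case (insert b B)
    have b: "b \<notin> B" using insert by auto
    have "{..<a} \<inter> insert b B = {..<a} \<inter> B" if "a \<in> B" for a using insert that by auto
    moreover have "{..<b} \<inter> insert b B = B" using insert by auto
    moreover have "Suc m * m = 2 * m + m * (m - 1)" for m by (cases m) auto
    ultimately show ?case using insert b by simp
  qed simp
  moreover have "beta_pairs B = (SIGMA a:B. {..<a} - B)" by (auto simp: beta_pairs_def)
  then have "card (beta_pairs B) = (\<Sum>a\<in>B. card ({..<a} - B))" using assms by simp
  moreover have "\<Sum>B = (\<Sum>a\<in>B. card ({..<a} \<inter> B)) + (\<Sum>a\<in>B. card ({..<a} - B))"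
    unfolding sum.distrib[symmetric]
  proof (rule sum.cong[OF refl])
    fix a show "a = card ({..<a} \<inter> B) + card ({..<a} - B)"
      using card_Int_Diff[of "{..<a}" B] by simp
  qed
  ultimately show ?thesis by simp
qed

lemma beta_sets_iff_card_pairs:
  "finite B \<Longrightarrow> B \<in> beta_sets N n \<longleftrightarrow> card B = N \<and> card (beta_pairs B) = n"
  using card_beta_pairs[of B] by (auto simp: beta_sets_def)

lemma card_hook_pairs_maya_of: "card (hook_pairs (maya_of L B)) = card (beta_pairs B)"
  unfolding hook_pairs_maya_of by (rule card_image[OF inj_on_shift2])

lemma finite_hook_pairs: "maya M \<Longrightarrow> finite (hook_pairs M)"
  by (erule maya_cases[of _ 0]) (simp add: hook_pairs_maya_of finite_beta_pairs)

lemma prod_hook_pairs_maya_of: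
  "(\<Prod>(a, b)\<in>hook_pairs (maya_of L B). g (a - b)) = (\<Prod>(a, b)\<in>beta_pairs B. g (int a - int b))"
  unfolding hook_pairs_maya_of by (subst prod.reindex[OF inj_on_shift2]) (auto intro: prod.cong)

lemma sum_odd_below_0: "(L::int) \<le> 0 \<Longrightarrow> (\<Sum>m\<in>{L..<0}. 2 * m + 1) = - (L * L)"
proof (induction L rule: int_le_induct)
  case (step i)
  have "{i - 1..<0} = insert (i - 1) {i..<0}" using step by auto
  then show ?case using step by (simp add: algebra_simps)
qed simp

text \<open>The ground state of charge \<open>c\<close> gives \<open>c\<^sup>2\<close>, as a sum of
  consecutive odd numbers, and each box moves an element up by one, which adds 2. The proof computes
  this in a window \<open>L \<le> 0\<close>.\<close>

lemma normal_sum_odd: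
  assumes "maya M"
  shows "normal_sum (\<lambda>m. 2 * m + 1) M = (charge M)\<^sup>2 + 2 * int (card (hook_pairs M))"
proof -
  obtain L B where L: "L \<le> 0" and B: "finite B" "M = maya_of L B"
    using maya_cases[OF assms] by metis
  define k where "k = int (card B)"
  have "2 * int (card (beta_pairs B)) + k * (k - 1) = 2 * int (\<Sum>B)"
  proof -
    have "int (card B * (card B - 1)) = k * (k - 1)" by (cases "card B") (simp_all add: k_def algebra_simps)
    moreover have "int (2 * card (beta_pairs B) + card B * (card B - 1)) = int (2 * \<Sum>B)"
      using card_beta_pairs[OF B(1)] by (rule arg_cong)
    ultimately show ?thesis by simp
  qed
  moreover have "normal_sum (\<lambda>m. 2 * m + 1) M = 2 * int (\<Sum>B) + (2 * L + 1) * k + L * L"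
    unfolding B(2) normal_sum_maya_of[OF B(1) L] sum_odd_below_0[OF L]
    by (simp add: sum.distrib k_def algebra_simps) (simp add: sum_distrib_right)
  ultimately show ?thesis
    by (simp add: B card_hook_pairs_maya_of charge_maya_of[OF B(1)] flip: k_def)
      (simp add: power2_eq_square algebra_simps)
qed

text \<open>A partition with \<open>n\<close> boxes has at most \<open>n\<close> parts, so at charge
  \<open>c\<close> every place below \<open>c - n\<close> is filled, and the window starting there
  holds exactly \<open>n\<close> elements.\<close>

lemma bij_betw_maya_of:
  "bij_betw (maya_of (c - int n)) (beta_sets n n) {M. maya M \<and> charge M = c \<and> card (hook_pairs M) = n}"
  unfolding bij_betw_def
proof
  show "inj_on (maya_of (c - int n)) (beta_sets n n)"
  proof (rule inj_onI)
    fix B B' assume "maya_of (c - int n) B = maya_of (c - int n) B'"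
    then show "B = B'" using maya_of_iff by blast
  qed
  show "maya_of (c - int n) ` beta_sets n n = {M. maya M \<and> charge M = c \<and> card (hook_pairs M) = n}"
  proof (intro equalityI subsetI)
    fix M assume "M \<in> maya_of (c - int n) ` beta_sets n n"
    then obtain B where B: "B \<in> beta_sets n n" "M = maya_of (c - int n) B" by auto
    then have fin: "finite B" by (simp add: beta_sets_def)
    then show "M \<in> {M. maya M \<and> charge M = c \<and> card (hook_pairs M) = n}"
      using B beta_sets_iff_card_pairs[OF fin]
      by (simp add: maya_maya_of charge_maya_of card_hook_pairs_maya_of)
  next
    fix M assume "M \<in> {M. maya M \<and> charge M = c \<and> card (hook_pairs M) = n}"
    then have M: "maya M" "charge M = c" "card (hook_pairs M) = n" by auto
    have "k \<in> M" if k: "k < c - int n" for k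
    proof (rule ccontr)
      assume kM: "k \<notin> M"
      obtain L B where L: "L \<le> k" and B: "finite B" "M = maya_of L B"
        using maya_cases[OF M(1)] by metis
      \<comment> \<open>Every element above the hole \<open>k\<close> forms a hook pair with it, so
        there are at most \<open>n\<close> of them. The window then holds too few elements for
        charge \<open>c\<close>.\<close>
      have "inj_on (\<lambda>a. (a, k)) (M \<inter> {k..})" by (simp add: inj_on_def)
      then have "card (M \<inter> {k..}) = card ((\<lambda>a. (a, k)) ` (M \<inter> {k..}))" by (simp add: card_image)
      also have "\<dots> \<le> card (hook_pairs M)"
        by (rule card_mono[OF finite_hook_pairs[OF M(1)]])
          (use kM in \<open>auto simp: hook_pairs_def order.order_iff_strict\<close>)
      finally have "card (M \<inter> {k..}) \<le> n" using M by simp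
      moreover have "card B = card (M \<inter> {L..})"
        unfolding B maya_of_inter by (simp add: card_image inj_on_shift)
      moreover have "card (M \<inter> {L..}) \<le> card ({L..<k} \<union> (M \<inter> {k..}))"
        by (rule card_mono) (use maya_finite[OF M(1)] in auto)
      moreover have "card ({L..<k} \<union> (M \<inter> {k..})) \<le> card {L..<k} + card (M \<inter> {k..})"
        by (rule card_Un_le)
      ultimately have "int (card B) \<le> k - L + int n" using L by simp
      then show False using k M(2) charge_maya_of[OF B(1), of L] B by simp
    qed
    then obtain B where B: "finite B" "M = maya_of (c - int n) B"
      using maya_of_window[OF M(1), of "c - int n"] by blast
    then have "card B = n" using charge_maya_of[OF B(1), of "c - int n"] M by simp
    then have "B \<in> beta_sets n n"
      using M B beta_sets_iff_card_pairs[OF B(1)] by (simp add: card_hook_pairs_maya_of)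
    then show "M \<in> maya_of (c - int n) ` beta_sets n n" using B by simp
  qed
qed

section \<open>Size and generating function of one slice\<close>

text \<open>This is the contribution of class \<open>r\<close> together with its mirror class: a
  hole at \<open>m < 0\<close> stands for the nonnegative element \<open>- 1 - (r + t m)\<close> and
  counts with the opposite sign. For \<open>r < t\<close> nothing is truncated, see
  \<open>int_slice_size\<close>.\<close>

definition slice_size :: "nat \<Rightarrow> nat \<Rightarrow> int set \<Rightarrow> nat" where
  "slice_size t r M = nat (normal_sum (\<lambda>m. 2 * (int r + int t * m) + 1) M)"

text \<open>The sum of \<open>2 (r + t m) + 1\<close> over \<open>0 \<le> m < c\<close>, continued
  to negative \<open>c\<close>: the \<open>slice_size\<close> of the ground state of charge
  \<open>c\<close>.\<close>

definition charge_size :: "nat \<Rightarrow> nat \<Rightarrow> int \<Rightarrow> nat" where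
  "charge_size t r c = nat (int t * c\<^sup>2 + (2 * int r + 1 - int t) * c)"

text \<open>The linear coefficient is at most \<open>t - 1\<close> in absolute value, and
  \<open>\<bar>c\<bar>\<close> is at most \<open>c\<^sup>2\<close>. The bound excludes truncation in
  \<open>charge_size\<close> and makes its fibres finite.\<close>

lemma charge_size_ge:
  assumes "r < t"
  shows "\<bar>c\<bar> \<le> int t * c\<^sup>2 + (2 * int r + 1 - int t) * c"
proof -
  have "\<bar>(2 * int r + 1 - int t) * c\<bar> \<le> (int t - 1) * \<bar>c\<bar>"
    unfolding abs_mult using assms by (intro mult_right_mono) auto
  moreover have "\<bar>c\<bar> * 1 \<le> \<bar>c\<bar> * \<bar>c\<bar>"
    by (cases "c = 0", simp, intro mult_left_mono) auto
  then have "int t * \<bar>c\<bar> \<le> int t * c\<^sup>2" by (intro mult_left_mono) (auto simp: power2_eq_square)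
  ultimately show ?thesis by (simp add: algebra_simps)
qed

text \<open>The summand is \<open>t (2 m + 1)\<close> plus the constant \<open>2 r + 1 - t\<close>,
  so \<open>normal_sum_odd\<close> and the charge determine the sum.\<close>

lemma slice_size_eq:
  assumes "maya M" "r < t"
  shows "slice_size t r M = charge_size t r (charge M) + 2 * t * card (hook_pairs M)"
proof -
  have "normal_sum (\<lambda>m. 2 * (int r + int t * m) + 1) M
      = normal_sum (\<lambda>m. int t * (2 * m + 1) + (2 * int r + 1 - int t) * 1) M"
    by (simp add: algebra_simps)
  also have "\<dots> = int t * normal_sum (\<lambda>m. 2 * m + 1) M + (2 * int r + 1 - int t) * charge M"
    unfolding charge_def by (rule normal_sum_linear)
  also have "\<dots> = (int t * (charge M)\<^sup>2 + (2 * int r + 1 - int t) * charge M) + int (2 * t * card (hook_pairs M))"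
    unfolding normal_sum_odd[OF assms(1)] by (simp add: algebra_simps)
  finally have "normal_sum (\<lambda>m. 2 * (int r + int t * m) + 1) M
      = (int t * (charge M)\<^sup>2 + (2 * int r + 1 - int t) * charge M) + int (2 * t * card (hook_pairs M))" .
  moreover have "0 \<le> int t * (charge M)\<^sup>2 + (2 * int r + 1 - int t) * charge M"
    using charge_size_ge[OF assms(2), of "charge M"] by linarith
  ultimately show ?thesis
    unfolding slice_size_def charge_size_def by (simp only: nat_add_distrib of_nat_0_le_iff nat_int)
qed

lemma finite_fibres_charge_size:
  assumes "r < t"
  shows "finite_fibres UNIV (charge_size t r)"
  unfolding finite_fibres_def
proof
  fix n
  have "{c \<in> UNIV. charge_size t r c = n} \<subseteq> {- int n..int n}"
  proof
    fix c assume "c \<in> {c \<in> UNIV. charge_size t r c = n}"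
    then have "\<bar>c\<bar> \<le> int n"
      using charge_size_ge[OF assms, of c] by (simp add: charge_size_def)
    then show "c \<in> {- int n..int n}" by auto
  qed
  then show "finite {c \<in> UNIV. charge_size t r c = n}" by (rule finite_subset) simp
qed

text \<open>Diagrams are grouped by charge and number of hooks, which fix the size. Hook differences
  are unaffected by shifting the window, so the inner sum does not depend on the charge and the
  series factors.\<close>

lemma
  fixes g v :: "int \<Rightarrow> 'c::comm_ring_1"
  assumes "r < t"
  shows finite_fibres_slice_size: "finite_fibres {M. maya M} (slice_size t r)"
    and gf_slice: "gf {M. maya M} (slice_size t r) (\<lambda>M. v (charge M) * (\<Prod>(a, b)\<in>hook_pairs M. g (a - b)))
      = gf UNIV (charge_size t r) v
        * gf UNIV (\<lambda>n. 2 * t * n) (\<lambda>n. \<Sum>B\<in>beta_sets n n. \<Prod>(a, b)\<in>beta_pairs B. g (int a - int b))"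
proof -
  let ?h = "\<lambda>M. (charge M, card (hook_pairs M))"
  let ?s = "\<lambda>(c, n). charge_size t r c + 2 * t * n"
  let ?w = "\<lambda>M. v (charge M) * (\<Prod>(a, b)\<in>hook_pairs M. g (a - b))"
  have fin1: "finite_fibres UNIV (\<lambda>n. 2 * t * n)" using finite_fibres_mult[of "2 * t"] assms by simp
  have fin2: "finite_fibres (UNIV \<times> UNIV) ?s"
    by (rule finite_fibres_times[OF finite_fibres_charge_size[OF assms] fin1])
  have size: "?s (?h M) = slice_size t r M" if "M \<in> {M. maya M}" for M
    using slice_size_eq[OF _ assms] that by simp
  have fiber: "{M \<in> {M. maya M}. ?h M = (c, n)} = {M. maya M \<and> charge M = c \<and> card (hook_pairs M) = n}" for c n
    by auto
  show fin3: "finite_fibres {M. maya M} (slice_size t r)"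
    unfolding finite_fibres_def
  proof
    fix k
    have fib: "finite {M \<in> {M. maya M}. ?h M = p}" for p
      using bij_betw_finite[OF bij_betw_maya_of[of "fst p" "snd p"]] finite_beta_sets[of "snd p" "snd p"]
        fiber[of "fst p" "snd p"] by simp
    have "finite {p \<in> UNIV \<times> UNIV. ?s p = k}"
      using fin2 unfolding finite_fibres_def by blast
    then have "finite (\<Union>p\<in>{p \<in> UNIV \<times> UNIV. ?s p = k}. {M \<in> {M. maya M}. ?h M = p})"
      using fib by (rule finite_UN_I)
    moreover have "{M \<in> {M. maya M}. slice_size t r M = k}
        \<subseteq> (\<Union>p\<in>{p \<in> UNIV \<times> UNIV. ?s p = k}. {M \<in> {M. maya M}. ?h M = p})"
      using size by auto
    ultimately show "finite {M \<in> {M. maya M}. slice_size t r M = k}"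
      by (rule rev_finite_subset)
  qed
  have "gf {M. maya M} (slice_size t r) ?w = gf (UNIV \<times> UNIV) ?s (\<lambda>p. \<Sum>M\<in>{M \<in> {M. maya M}. ?h M = p}. ?w M)"
    by (rule gf_group[OF fin3 fin2]) (use size in auto)
  also have "(\<lambda>p. \<Sum>M\<in>{M \<in> {M. maya M}. ?h M = p}. ?w M)
      = (\<lambda>(c, n). v c * (\<Sum>B\<in>beta_sets n n. \<Prod>(a, b)\<in>beta_pairs B. g (int a - int b)))"
  proof (rule ext, clarify)
    fix c n
    have "(\<Sum>M\<in>{M \<in> {M. maya M}. ?h M = (c, n)}. ?w M) = (\<Sum>B\<in>beta_sets n n. ?w (maya_of (c - int n) B))"
      unfolding fiber by (rule sum.reindex_bij_betw[OF bij_betw_maya_of, symmetric])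
    also have "\<dots> = (\<Sum>B\<in>beta_sets n n. v c * (\<Prod>(a, b)\<in>beta_pairs B. g (int a - int b)))"
      by (rule sum.cong[OF refl]) (auto simp: prod_hook_pairs_maya_of charge_maya_of beta_sets_def)
    finally show "(\<Sum>M\<in>{M \<in> {M. maya M}. ?h M = (c, n)}. ?w M)
        = v c * (\<Sum>B\<in>beta_sets n n. \<Prod>(a, b)\<in>beta_pairs B. g (int a - int b))"
      by (simp add: sum_distrib_left)
  qed
  finally show "gf {M. maya M} (slice_size t r) ?w = gf UNIV (charge_size t r) v
      * gf UNIV (\<lambda>n. 2 * t * n) (\<lambda>n. \<Sum>B\<in>beta_sets n n. \<Prod>(a, b)\<in>beta_pairs B. g (int a - int b))"
    unfolding gf_times[OF finite_fibres_charge_size[OF assms] fin1] .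
qed

section \<open>Residue classes of symmetric sets\<close>

definition sym_sets :: "int set set" where
  "sym_sets = {S. (\<forall>k. - 1 - k \<in> S \<longleftrightarrow> k \<notin> S) \<and> finite (S \<inter> {0..})}"

definition slice :: "nat \<Rightarrow> int set \<Rightarrow> nat \<Rightarrow> int set" where
  "slice t S r = {m. int r + int t * m \<in> S}"

text \<open>
  The residue classes \<open>r\<close> and \<open>t - 1 - r\<close> mirror each other, so the slices with \<open>r < t div 2\<close> are free and
  determine the others. For even \<open>t\<close> no class is its own mirror image.
\<close>

definition unslice :: "nat \<Rightarrow> (nat \<Rightarrow> int set) \<Rightarrow> int set" where
  "unslice t F = {k. if nat (k mod int t) < t div 2 then k div int t \<in> F (nat (k mod int t))
     else (- 1 - k) div int t \<notin> F (nat ((- 1 - k) mod int t))}"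

lemma mirror_div_mod:
  fixes k t :: int
  assumes "t > 0"
  shows "(- 1 - k) div t = - 1 - k div t" "(- 1 - k) mod t = t - 1 - k mod t"
proof -
  have "- 1 - k = t * (- 1 - k div t) + (t - 1 - k mod t)"
    using mult_div_mod_eq[of t k] by (simp add: algebra_simps)
  moreover have "0 \<le> t - 1 - k mod t" "t - 1 - k mod t < t"
    using pos_mod_sign[OF assms, of k] pos_mod_bound[OF assms, of k] by linarith+
  ultimately show "(- 1 - k) div t = - 1 - k div t" "(- 1 - k) mod t = t - 1 - k mod t"
    using int_div_pos_eq int_mod_pos_eq by blast+
qed

lemma residue_div_mod:
  fixes t r :: nat
  assumes "r < t"
  shows "(int r + int t * m) div int t = m" "(int r + int t * m) mod int t = int r"
  using int_div_pos_eq[of "int r + int t * m" "int t" m "int r"]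
    int_mod_pos_eq[of "int r + int t * m" "int t" m "int r"] assms by simp_all

lemma sym_setsD: "S \<in> sym_sets \<Longrightarrow> - 1 - k \<in> S \<longleftrightarrow> k \<notin> S"
  by (simp add: sym_sets_def)

text \<open>The mirror image of a negative hole is a nonnegative element, and of these there are
  finitely many.\<close>

lemma maya_sym_set:
  assumes "S \<in> sym_sets"
  shows "maya S"
  unfolding maya_def
proof -
  have fin: "finite (S \<inter> {0..})" using assms by (simp add: sym_sets_def)
  then obtain N where N: "\<forall>k\<in>S \<inter> {0..}. k \<le> N"
    by (metis bdd_above.E bdd_above_finite)
  define L where "L = - 1 - max N 0"
  have "k \<in> S" if "k < L" for k
  proof (rule ccontr)
    assume "k \<notin> S"
    then have "- 1 - k \<in> S" using sym_setsD[OF assms] by simp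
    moreover have "0 \<le> - 1 - k" using that by (simp add: L_def)
    ultimately have "- 1 - k \<le> N" using N by blast
    then show False using that by (simp add: L_def)
  qed
  moreover have "S \<inter> {L..} \<subseteq> (S \<inter> {0..}) \<union> {L..<0}" by auto
  then have "finite (S \<inter> {L..})" using fin finite_subset by blast
  ultimately show "\<exists>L. {..<L} \<subseteq> S \<and> finite (S \<inter> {L..})" by auto
qed

lemma maya_slice:
  assumes "S \<in> sym_sets" "r < t"
  shows "maya (slice t S r)"
proof -
  obtain L where L: "{..<L} \<subseteq> S" "finite (S \<inter> {L..})"
    using maya_sym_set[OF assms(1)] by (auto simp: maya_def)
  \<comment> \<open>The cap at 0 gives \<open>m + 1 \<le> 0\<close>, whence
    \<open>r + t m = (r - t) + t (m + 1) < m + 1 \<le> L\<close>.\<close>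
  define K where "K = min L 0"
  have "int r + int t * m < L" if "m < K" for m
  proof -
    have "int t * (m + 1) \<le> 1 * (m + 1)"
      by (rule mult_right_mono_neg) (use that assms in \<open>auto simp: K_def\<close>)
    then show ?thesis using that assms by (simp add: K_def algebra_simps)
  qed
  then have "{..<K} \<subseteq> slice t S r" using L(1) by (auto simp: slice_def)
  moreover have "finite (slice t S r \<inter> {K..})"
  proof -
    let ?f = "\<lambda>m. int r + int t * m"
    have "inj_on ?f A" for A using assms by (auto simp: inj_on_def)
    moreover have "finite (S \<inter> {int r + int t * K..})"
      by (rule maya_finite(1)[OF maya_sym_set[OF assms(1)]])
    moreover have "?f ` (slice t S r \<inter> {K..}) \<subseteq> S \<inter> {int r + int t * K..}"
      using assms by (auto simp: slice_def)
    ultimately show ?thesis by (meson inj_on_finite)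
  qed
  ultimately show ?thesis by (auto simp: maya_def)
qed

text \<open>An element \<open>k \<ge> 0\<close> in an upper class corresponds to the hole
  \<open>- 1 - k\<close> in a lower class, at a negative place \<open>m\<close>. Since
  \<open>f\<close> is odd under the reflection, this is exactly the negative term of
  \<open>normal_sum\<close>.\<close>

lemma sum_sym_set:
  fixes f :: "int \<Rightarrow> int"
  assumes S: "S \<in> sym_sets" and t: "even t" "t > 0" and f: "\<And>k. f (- 1 - k) = - f k"
  shows "(\<Sum>k\<in>S \<inter> {0..}. f k) = (\<Sum>r<t div 2. normal_sum (\<lambda>m. f (int r + int t * m)) (slice t S r))"
proof -
  let ?u = "t div 2"
  have u: "t = 2 * ?u" using t by simp
  have res: "r < ?u \<Longrightarrow> r < t" for r using u by simp
  have fin: "finite (S \<inter> {0..})" using S by (simp add: sym_sets_def)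
  let ?A = "{k \<in> S \<inter> {0..}. nat (k mod int t) < ?u}"
  let ?B = "{k \<in> S \<inter> {0..}. \<not> nat (k mod int t) < ?u}"
  have fs: "finite (slice t S r \<inter> {0..})" "finite ({..<0} - slice t S r)" if "r < ?u" for r
    using maya_finite[OF maya_slice[OF S res[OF that]]] by auto
  have mt: "0 \<le> k mod int t" "k mod int t < int t" for k using t by auto
  have kt: "k mod int t + int t * (k div int t) = k" for k by simp
  have "(\<Sum>k\<in>S \<inter> {0..}. f k) = (\<Sum>k\<in>?A. f k) + (\<Sum>k\<in>?B. f k)"
    using sum.Int_Diff[OF fin, of f "{k. nat (k mod int t) < ?u}"]
    by (simp add: Int_def set_diff_eq conj_ac)
  also have "(\<Sum>k\<in>?A. f k) = (\<Sum>(r, m)\<in>(SIGMA r:{..<?u}. slice t S r \<inter> {0..}). f (int r + int t * m))"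
  proof (rule sum.reindex_bij_witness[of _ "\<lambda>(r, m). int r + int t * m" "\<lambda>k. (nat (k mod int t), k div int t)"])
    fix k assume k: "k \<in> ?A"
    have e: "int (nat (k mod int t)) + int t * (k div int t) = k"
      using mt[of k] kt[of k] by simp
    then show "(case (nat (k mod int t), k div int t) of (r, m) \<Rightarrow> int r + int t * m) = k"
      and "(case (nat (k mod int t), k div int t) of (r, m) \<Rightarrow> f (int r + int t * m)) = f k"
      by (simp_all only: prod.case)
    have "0 \<le> k div int t" using k t by (simp add: pos_imp_zdiv_nonneg_iff)
    then show "(nat (k mod int t), k div int t) \<in> (SIGMA r:{..<?u}. slice t S r \<inter> {0..})"
      using e k by (simp add: slice_def)
  next
    fix p assume "p \<in> (SIGMA r:{..<?u}. slice t S r \<inter> {0..})"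
    then obtain r m where p: "p = (r, m)" "r < ?u" "m \<ge> 0" "int r + int t * m \<in> S"
      by (auto simp: slice_def)
    note dm = residue_div_mod[OF res[OF p(2)], of m]
    show "(nat ((case p of (r, m) \<Rightarrow> int r + int t * m) mod int t), (case p of (r, m) \<Rightarrow> int r + int t * m) div int t) = p"
      unfolding p(1) by (simp only: prod.case dm nat_int)
    show "(case p of (r, m) \<Rightarrow> int r + int t * m) \<in> ?A"
      unfolding p(1) using p by (simp only: prod.case dm nat_int mem_Collect_eq) simp
  qed
  also have "(\<Sum>k\<in>?B. f k) = (\<Sum>(r, m)\<in>(SIGMA r:{..<?u}. {..<0} - slice t S r). - f (int r + int t * m))"
  proof (rule sum.reindex_bij_witness[of _ "\<lambda>(r, m). - 1 - (int r + int t * m)"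
        "\<lambda>k. (nat ((- 1 - k) mod int t), (- 1 - k) div int t)"])
    fix k assume k: "k \<in> ?B"
    have e: "int (nat ((- 1 - k) mod int t)) + int t * ((- 1 - k) div int t) = - 1 - k"
      using mt[of "- 1 - k"] kt[of "- 1 - k"] by simp
    then show "(case (nat ((- 1 - k) mod int t), (- 1 - k) div int t) of (r, m) \<Rightarrow> - 1 - (int r + int t * m)) = k"
      by simp
    show "(case (nat ((- 1 - k) mod int t), (- 1 - k) div int t) of (r, m) \<Rightarrow> - f (int r + int t * m)) = f k"
      using e f[of k] by simp
    have "nat ((- 1 - k) mod int t) < ?u"
      using k u mirror_div_mod(2)[of "int t" k] t by auto
    moreover have "(- 1 - k) div int t < 0"
    proof -
      have "0 \<le> k div int t" using k t by (simp add: pos_imp_zdiv_nonneg_iff)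
      then show ?thesis using mirror_div_mod(1)[of "int t" k] t by linarith
    qed
    moreover have "- 1 - k \<notin> S" using k sym_setsD[OF S] by auto
    ultimately show "(nat ((- 1 - k) mod int t), (- 1 - k) div int t) \<in> (SIGMA r:{..<?u}. {..<0} - slice t S r)"
      using e by (simp add: slice_def)
  next
    fix p assume "p \<in> (SIGMA r:{..<?u}. {..<0} - slice t S r)"
    then obtain r m where p: "p = (r, m)" "r < ?u" "m < 0" "int r + int t * m \<notin> S"
      by (auto simp: slice_def)
    let ?k = "- 1 - (int r + int t * m)"
    have k: "- 1 - ?k = int r + int t * m" by simp
    have dm: "(- 1 - ?k) div int t = m" "(- 1 - ?k) mod int t = int r"
      unfolding k using residue_div_mod[OF res[OF p(2)]] by auto
    then show "(nat ((- 1 - (case p of (r, m) \<Rightarrow> - 1 - (int r + int t * m))) mod int t),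
        (- 1 - (case p of (r, m) \<Rightarrow> - 1 - (int r + int t * m))) div int t) = p"
      unfolding p(1) by (simp only: prod.case nat_int)
    have kd: "?k div int t = - 1 - m" "?k mod int t = int t - 1 - int r"
      using mirror_div_mod[of "int t" "int r + int t * m"] residue_div_mod[OF res[OF p(2)]] t by auto
    have "?k \<ge> 0" using kd(1) p(3) t pos_imp_zdiv_nonneg_iff[of "int t" ?k] by simp
    moreover have "\<not> nat (?k mod int t) < ?u" unfolding kd(2) using p(2) u by simp
    moreover have "?k \<in> S" using sym_setsD[OF S, of "int r + int t * m"] p(4) by simp
    ultimately show "(case p of (r, m) \<Rightarrow> - 1 - (int r + int t * m)) \<in> ?B"
      unfolding p(1) by simp
  qed
  also have "(\<Sum>(r, m)\<in>(SIGMA r:{..<?u}. slice t S r \<inter> {0..}). f (int r + int t * m))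
      = (\<Sum>r<?u. \<Sum>m\<in>slice t S r \<inter> {0..}. f (int r + int t * m))"
    by (rule sum.Sigma[symmetric]) (use fs in auto)
  also have "(\<Sum>(r, m)\<in>(SIGMA r:{..<?u}. {..<0} - slice t S r). - f (int r + int t * m))
      = (\<Sum>r<?u. \<Sum>m\<in>{..<0} - slice t S r. - f (int r + int t * m))"
    by (rule sum.Sigma[symmetric]) (use fs in auto)
  finally show ?thesis by (simp add: normal_sum_def sum_subtractf sum_negf)
qed

lemma bij_betw_slice:
  assumes t: "even t" "t > 0"
  shows "bij_betw (\<lambda>S. restrict (slice t S) {..<t div 2}) sym_sets (\<Pi>\<^sub>E r\<in>{..<t div 2}. {M. maya M})"
proof (rule bij_betwI[where g = "unslice t"])
  let ?u = "t div 2"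
  have u: "t = 2 * ?u" using t by simp
  have mt: "0 \<le> k mod int t" "k mod int t < int t" for k using t by auto
  have kt: "k mod int t + int t * (k div int t) = k" for k by simp
  have swap: "nat ((- 1 - k) mod int t) < ?u \<longleftrightarrow> \<not> nat (k mod int t) < ?u" for k
    using mirror_div_mod(2)[of "int t" k] mt[of k] u t by auto
  show "(\<lambda>S. restrict (slice t S) {..<?u}) \<in> sym_sets \<rightarrow> (\<Pi>\<^sub>E r\<in>{..<?u}. {M. maya M})"
    using u by (auto intro!: maya_slice)
  show "unslice t \<in> (\<Pi>\<^sub>E r\<in>{..<?u}. {M. maya M}) \<rightarrow> sym_sets"
  proof
    fix F assume F: "F \<in> (\<Pi>\<^sub>E r\<in>{..<?u}. {M. maya M})"
    then have m: "finite (F r \<inter> {0..})" "finite ({..<0} - F r)" if "r < ?u" for r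
      using that maya_finite[of "F r"] by auto
    have "unslice t F \<inter> {0..} \<subseteq> (\<Union>r\<in>{..<?u}. (\<lambda>m. int r + int t * m) ` (F r \<inter> {0..})
        \<union> (\<lambda>m. - 1 - (int r + int t * m)) ` ({..<0} - F r))" (is "_ \<subseteq> ?R")
    proof
      fix k assume k: "k \<in> unslice t F \<inter> {0..}"
      show "k \<in> ?R"
      proof (cases "nat (k mod int t) < ?u")
        case True
        have "k = int (nat (k mod int t)) + int t * (k div int t)" using mt[of k] by simp
        moreover have "k div int t \<in> F (nat (k mod int t)) \<inter> {0..}"
          using k True t by (auto simp: unslice_def pos_imp_zdiv_nonneg_iff)
        ultimately show ?thesis using True by blast
      next
        case False
        define j where "j = - 1 - k"
        have "k = - 1 - (int (nat (j mod int t)) + int t * (j div int t))"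
          using mt[of j] by (simp add: j_def)
        moreover have "j div int t \<in> {..<0} - F (nat (j mod int t))"
          using k False t unfolding j_def unslice_def by (auto simp: pos_imp_zdiv_neg_iff)
        moreover have "nat (j mod int t) < ?u" using False swap unfolding j_def by blast
        ultimately show ?thesis by blast
      qed
    qed
    moreover have "finite ?R" using m by auto
    ultimately have "finite (unslice t F \<inter> {0..})" by (rule finite_subset)
    moreover have "- 1 - k \<in> unslice t F \<longleftrightarrow> k \<notin> unslice t F" for k
      using swap[of k] by (auto simp: unslice_def)
    ultimately show "unslice t F \<in> sym_sets" by (simp add: sym_sets_def)
  qed
  show "unslice t (restrict (slice t S) {..<?u}) = S" if S: "S \<in> sym_sets" for S
  proof (rule set_eqI)
    fix k
    have e: "k div int t \<in> slice t S (nat (k mod int t)) \<longleftrightarrow> k \<in> S" for k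
      using mt[of k] kt[of k] by (simp add: slice_def)
    show "k \<in> unslice t (restrict (slice t S) {..<?u}) \<longleftrightarrow> k \<in> S"
      using swap[of k] e[of k] e[of "- 1 - k"] sym_setsD[OF S, of k] by (auto simp: unslice_def)
  qed
  show "restrict (slice t (unslice t F)) {..<?u} = F" if F: "F \<in> (\<Pi>\<^sub>E r\<in>{..<?u}. {M. maya M})" for F
  proof
    fix r
    show "restrict (slice t (unslice t F)) {..<?u} r = F r"
    proof (cases "r < ?u")
      case True
      then have "r < t" using u by simp
      then show ?thesis using True residue_div_mod[of r t] by (simp add: slice_def unslice_def)
    next
      case False
      then show ?thesis using PiE_arb[OF F, of r] by simp
    qed
  qed
qed

text \<open>Reflection with complement is conjugation: elements and holes trade places, and the
  differences survive.\<close>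

lemma hook_pairs_mirror:
  "hook_pairs {m. - 1 - m \<notin> M} = (\<lambda>(a, b). (- 1 - b, - 1 - a)) ` hook_pairs M"
proof (intro equalityI subsetI)
  fix p assume "p \<in> hook_pairs {m. - 1 - m \<notin> M}"
  then show "p \<in> (\<lambda>(a, b). (- 1 - b, - 1 - a)) ` hook_pairs M"
    by (intro image_eqI[of _ _ "(- 1 - snd p, - 1 - fst p)"]) (auto simp: hook_pairs_def)
qed (auto simp: hook_pairs_def)

text \<open>The ends of a hook divisible by \<open>t\<close> lie in one class, and the hook is
  \<open>t\<close> times a hook of that slice. Slices \<open>r\<close> and \<open>t - 1 - r\<close>
  are conjugate, hence the squares.\<close>

lemma prod_hook_pairs_sym_set:
  fixes g :: "int \<Rightarrow> 'c::comm_monoid_mult"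
  assumes S: "S \<in> sym_sets" and t: "even t" "t > 0"
  shows "(\<Prod>(a, b)\<in>{(a, b) \<in> hook_pairs S. int t dvd a - b}. g (a - b))
    = (\<Prod>r<t div 2. \<Prod>(a, b)\<in>hook_pairs (slice t S r). (g (int t * (a - b)))\<^sup>2)"
proof -
  let ?u = "t div 2"
  let ?P = "\<lambda>r. \<Prod>(a, b)\<in>hook_pairs (slice t S r). g (int t * (a - b))"
  have u: "t = 2 * ?u" using t by simp
  have mt: "0 \<le> k mod int t" "k mod int t < int t" for k using t by auto
  have kt: "k mod int t + int t * (k div int t) = k" for k by simp
  have "(\<Prod>(a, b)\<in>{(a, b) \<in> hook_pairs S. int t dvd a - b}. g (a - b))
      = (\<Prod>(r, p)\<in>(SIGMA r:{..<t}. hook_pairs (slice t S r)). case p of (a, b) \<Rightarrow> g (int t * (a - b)))"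
  proof (rule prod.reindex_bij_witness[of _ "\<lambda>(r, (a, b)). (int r + int t * a, int r + int t * b)"
        "\<lambda>(a, b). (nat (a mod int t), (a div int t, b div int t))"])
    fix p assume "p \<in> {(a, b) \<in> hook_pairs S. int t dvd a - b}"
    then obtain a b where p: "p = (a, b)" "a \<in> S" "b \<notin> S" "b < a" "int t dvd a - b"
      by (auto simp: hook_pairs_def)
    have ab: "b mod int t = a mod int t" using p(5) by (metis mod_eq_dvd_iff)
    have a: "int (nat (a mod int t)) + int t * (a div int t) = a"
      and b: "int (nat (a mod int t)) + int t * (b div int t) = b"
      using mt[of a] kt[of a] kt[of b] ab by auto
    from a b show "(case case p of (a, b) \<Rightarrow> (nat (a mod int t), (a div int t, b div int t)) of
        (r, (a, b)) \<Rightarrow> (int r + int t * a, int r + int t * b)) = p"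
      unfolding p(1) by (simp only: prod.case)
    have d: "a - b = int t * (a div int t - b div int t)"
      using a b by (metis add_diff_cancel_left right_diff_distrib)
    then show "(case case p of (a, b) \<Rightarrow> (nat (a mod int t), (a div int t, b div int t)) of
        (r, p) \<Rightarrow> case p of (a, b) \<Rightarrow> g (int t * (a - b))) = (case p of (a, b) \<Rightarrow> g (a - b))"
      unfolding p(1) by (simp only: prod.case)
    have "0 < int t * (a div int t - b div int t)" using d p(4) by simp
    then have "b div int t < a div int t" by (simp add: zero_less_mult_iff)
    then have "(a div int t, b div int t) \<in> hook_pairs (slice t S (nat (a mod int t)))"
      unfolding hook_pairs_def slice_def using a b p by simp
    moreover have "nat (a mod int t) < t" using mt[of a] by simp
    ultimately show "(case p of (a, b) \<Rightarrow> (nat (a mod int t), (a div int t, b div int t)))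
        \<in> (SIGMA r:{..<t}. hook_pairs (slice t S r))"
      unfolding p(1) by simp
  next
    fix q assume "q \<in> (SIGMA r:{..<t}. hook_pairs (slice t S r))"
    then obtain r a b where q: "q = (r, (a, b))" "r < t" "b < a" "int r + int t * a \<in> S" "int r + int t * b \<notin> S"
      by (auto simp: hook_pairs_def slice_def)
    show "(case case q of (r, (a, b)) \<Rightarrow> (int r + int t * a, int r + int t * b) of
        (a, b) \<Rightarrow> (nat (a mod int t), (a div int t, b div int t))) = q"
      unfolding q(1) using residue_div_mod[OF q(2)] by simp
    have "int r + int t * a - (int r + int t * b) = int t * (a - b)" by (simp add: algebra_simps)
    then show "(case q of (r, (a, b)) \<Rightarrow> (int r + int t * a, int r + int t * b)) \<in> {(a, b) \<in> hook_pairs S. int t dvd a - b}"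
      unfolding q(1) using q t by (simp add: hook_pairs_def)
  qed
  also have "\<dots> = (\<Prod>r<t. ?P r)"
    by (rule prod.Sigma[symmetric]) (use maya_slice[OF S] finite_hook_pairs in auto)
  also have "{..<t} = {..<?u} \<union> {?u..<t}" using u by auto
  also have "(\<Prod>r\<in>{..<?u} \<union> {?u..<t}. ?P r) = (\<Prod>r<?u. ?P r) * (\<Prod>r\<in>{?u..<t}. ?P r)"
    by (rule prod.union_disjoint) auto
  also have "(\<Prod>r\<in>{?u..<t}. ?P r) = (\<Prod>r<?u. ?P (t - 1 - r))"
    by (rule prod.reindex_bij_witness[of _ "\<lambda>r. t - 1 - r" "\<lambda>r. t - 1 - r"]) (use u in auto)
  also have "\<dots> = (\<Prod>r<?u. ?P r)"
  proof (rule prod.cong[OF refl])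
    fix r assume "r \<in> {..<?u}"
    then have r: "int (t - 1 - r) = int t - 1 - int r" using u by auto
    have "slice t S (t - 1 - r) = {m. - 1 - m \<notin> slice t S r}"
    proof (rule set_eqI)
      fix m
      have "- 1 - (int (t - 1 - r) + int t * m) = int r + int t * (- 1 - m)"
        unfolding r by (simp add: algebra_simps)
      then show "m \<in> slice t S (t - 1 - r) \<longleftrightarrow> m \<in> {m. - 1 - m \<notin> slice t S r}"
        using sym_setsD[OF S, of "int (t - 1 - r) + int t * m"] by (simp add: slice_def)
    qed
    moreover have "inj_on (\<lambda>(a, b). (- 1 - b, - 1 - a)) A" for A :: "(int \<times> int) set"
      by (auto simp: inj_on_def)
    ultimately show "?P (t - 1 - r) = ?P r"
      by (simp only: hook_pairs_mirror prod.reindex) (auto intro!: prod.cong)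
  qed
  finally show ?thesis
    by (simp add: power2_eq_square prod.distrib split_def)
qed

section \<open>Maya diagrams of partitions\<close>

text \<open>Rows beyond the last one take part: their zero parts supply all integers below
  \<open>- length \<mu>\<close>.\<close>

definition maya_set :: "nat list \<Rightarrow> int set" where
  "maya_set \<mu> = {int (part \<mu> i) - int i |i. 1 \<le> i}"

text \<open>This is \<open>(- 1)\<^sup>k\<close> for integer \<open>k\<close>, which may be
  negative.\<close>

definition alt_sign :: "int \<Rightarrow> int" where
  "alt_sign k = (if even k then 1 else - 1)"

lemma maya_setI: "1 \<le> i \<Longrightarrow> int (part \<mu> i) - int i \<in> maya_set \<mu>"
  by (auto simp: maya_set_def)

lemma maya_setE:
  assumes "k \<in> maya_set \<mu>"
  obtains i where "1 \<le> i" "k = int (part \<mu> i) - int i"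
  using assms by (auto simp: maya_set_def)

lemma part_Suc: "i < length \<mu> \<Longrightarrow> part \<mu> (Suc i) = \<mu> ! i"
  by (simp add: part_def)

lemma part_beyond: "length \<mu> < i \<Longrightarrow> part \<mu> i = 0"
  by (simp add: part_def)

lemma part_antimono:
  assumes "is_partition \<mu>" "1 \<le> i" "i \<le> j"
  shows "part \<mu> j \<le> part \<mu> i"
proof (cases "j \<le> length \<mu> \<and> i < j")
  case True
  then have "\<mu> ! (j - 1) \<le> \<mu> ! (i - 1)"
    using assms unfolding is_partition_def by (intro sorted_wrt_nth_less[of "(\<ge>)" \<mu>]) auto
  then show ?thesis using True assms by (simp add: part_def)
next
  case False
  then show ?thesis using assms by (cases "i = j") (auto simp: part_def)
qed

lemma part_pos_iff:
  assumes "is_partition \<mu>" "1 \<le> i"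
  shows "0 < part \<mu> i \<longleftrightarrow> i \<le> length \<mu>"
proof
  assume "i \<le> length \<mu>"
  then have "\<mu> ! (i - 1) \<in> set \<mu>" using assms by auto
  then have "\<mu> ! (i - 1) \<noteq> 0" using assms(1) unfolding is_partition_def by metis
  then show "0 < part \<mu> i" using assms \<open>i \<le> length \<mu>\<close> by (simp add: part_def)
qed (use part_beyond[of \<mu> i] in \<open>auto simp: not_less[symmetric]\<close>)

lemma diagram_iff: "(i, j) \<in> diagram \<mu> \<longleftrightarrow> 1 \<le> i \<and> 1 \<le> j \<and> j \<le> part \<mu> i"
  by (auto simp: diagram_def part_def split: if_splits)

lemma part_conjugate:
  assumes "is_partition \<mu>" "1 \<le> j"
  shows "part (conjugate \<mu>) j = card {i \<in> {1..length \<mu>}. j \<le> part \<mu> i}"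
proof (cases "j \<le> part \<mu> 1")
  case True
  then have "[1..<Suc (part \<mu> 1)] ! (j - 1) = j" "j - 1 < length [1..<Suc (part \<mu> 1)]"
    using assms(2) by (simp_all del: upt_Suc)
  then show ?thesis using True assms(2)
    unfolding part_def[of "conjugate \<mu>"] unfolding conjugate_def by (simp del: upt_Suc)
next
  case False
  then have "\<not> j \<le> part \<mu> i" if "i \<in> {1..length \<mu>}" for i
    using part_antimono[OF assms(1), of 1 i] that by auto
  then have "{i \<in> {1..length \<mu>}. j \<le> part \<mu> i} = {}" by blast
  moreover have "part (conjugate \<mu>) j = 0"
    by (rule part_beyond) (use False in \<open>simp add: conjugate_def\<close>)
  ultimately show ?thesis by (simp only: card.empty)
qed

text \<open>The rows that reach column \<open>j\<close> form an initial segment, so belonging to it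
  means having an index at most its cardinality.\<close>

lemma le_part_conjugate_iff:
  assumes "is_partition \<mu>" "1 \<le> i" "1 \<le> j"
  shows "i \<le> part (conjugate \<mu>) j \<longleftrightarrow> j \<le> part \<mu> i"
proof -
  define A where "A = {i \<in> {1..length \<mu>}. j \<le> part \<mu> i}"
  have down: "k \<in> A" if "i \<in> A" "1 \<le> k" "k \<le> i" for i k
    using that part_antimono[OF assms(1), of k i] by (auto simp: A_def)
  have "i \<in> A \<longleftrightarrow> j \<le> part \<mu> i"
    using assms part_pos_iff[OF assms(1,2)] by (auto simp: A_def)
  moreover have "i \<in> A \<longleftrightarrow> i \<le> card A"
  proof
    assume "i \<in> A"
    then have "{1..i} \<subseteq> A" using down by auto
    then show "i \<le> card A" using card_mono[of A "{1..i}"] by (simp add: A_def)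
  next
    assume i: "i \<le> card A"
    show "i \<in> A"
    proof (rule ccontr)
      assume "i \<notin> A"
      then have "k < i" if "k \<in> A" for k
        using down[OF that assms(2)] by (meson not_le)
      then have "A \<subseteq> {1..<i}" by (auto simp: A_def)
      then have "card A \<le> card {1..<i}" by (intro card_mono) auto
      then show False using i assms(2) by simp
    qed
  qed
  ultimately show ?thesis using part_conjugate[OF assms(1,3)] by (simp add: A_def)
qed

lemma is_partition_conjugate:
  assumes "is_partition \<mu>"
  shows "is_partition (conjugate \<mu>)"
proof -
  have len: "length (conjugate \<mu>) = part \<mu> 1" by (simp add: conjugate_def)
  have "conjugate \<mu> ! k \<le> conjugate \<mu> ! j" if "j < k" "k < length (conjugate \<mu>)" for j k
  proof -
    define c where "c = conjugate \<mu> ! k"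
    have c: "c = part (conjugate \<mu>) (Suc k)" using that by (simp add: part_Suc c_def)
    have "c \<le> part (conjugate \<mu>) (Suc j)"
    proof (cases "c = 0")
      case False
      then have "Suc k \<le> part \<mu> c"
        using le_part_conjugate_iff[OF assms, of c "Suc k"] c by simp
      then show ?thesis
        using le_part_conjugate_iff[OF assms, of c "Suc j"] that False by simp
    qed simp
    then show ?thesis using that by (simp add: part_Suc c_def)
  qed
  moreover have "conjugate \<mu> ! k \<noteq> 0" if "k < length (conjugate \<mu>)" for k
    using le_part_conjugate_iff[OF assms, of 1 "Suc k"] that by (simp add: part_Suc len)
  ultimately show ?thesis
    by (auto simp: is_partition_def sorted_wrt_iff_nth_less in_set_conv_nth)
qed

lemma part_content_strict:
  assumes "is_partition \<mu>" "1 \<le> i" "i < j"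
  shows "int (part \<mu> j) - int j < int (part \<mu> i) - int i"
  using part_antimono[OF assms(1,2) less_imp_le[OF assms(3)]] assms(3) by linarith

lemma part_content_inject:
  assumes "is_partition \<mu>" "1 \<le> i" "1 \<le> j" "int (part \<mu> i) - int i = int (part \<mu> j) - int j"
  shows "i = j"
proof (rule ccontr)
  assume "i \<noteq> j"
  then consider "i < j" | "j < i" by linarith
  then show False
  proof cases
    case 1
    then show False using part_content_strict[OF assms(1,2) 1] assms(4) by simp
  next
    case 2
    then show False using part_content_strict[OF assms(1,3) 2] assms(4) by simp
  qed
qed

text \<open>The right side minus the left side is
  \<open>(\<mu>\<^sub>i - j) + (\<mu>'\<^sub>j - i) + 1\<close>. Inside the diagram both brackets
  are nonnegative, outside both are negative, so the difference is never 0.\<close>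

lemma part_content_less_iff:
  assumes "is_partition \<mu>" "1 \<le> i" "1 \<le> j"
  shows "int j - 1 - int (part (conjugate \<mu>) j) < int (part \<mu> i) - int i \<longleftrightarrow> j \<le> part \<mu> i"
    and "int j - 1 - int (part (conjugate \<mu>) j) \<noteq> int (part \<mu> i) - int i"
proof -
  have "(int j - 1 - int (part (conjugate \<mu>) j) < int (part \<mu> i) - int i \<longleftrightarrow> j \<le> part \<mu> i)
    \<and> int j - 1 - int (part (conjugate \<mu>) j) \<noteq> int (part \<mu> i) - int i"
  proof (cases "j \<le> part \<mu> i")
    case True
    moreover from this have "i \<le> part (conjugate \<mu>) j"
      using le_part_conjugate_iff[OF assms] by blast
    ultimately have "int j - 1 - int (part (conjugate \<mu>) j) < int (part \<mu> i) - int i" by linarith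
    then show ?thesis using True by simp
  next
    case False
    moreover from this have "\<not> i \<le> part (conjugate \<mu>) j"
      using le_part_conjugate_iff[OF assms] by blast
    ultimately have "int j - 1 - int (part (conjugate \<mu>) j) > int (part \<mu> i) - int i" by linarith
    then show ?thesis using False by simp
  qed
  then show "int j - 1 - int (part (conjugate \<mu>) j) < int (part \<mu> i) - int i \<longleftrightarrow> j \<le> part \<mu> i"
    and "int j - 1 - int (part (conjugate \<mu>) j) \<noteq> int (part \<mu> i) - int i" by blast+
qed

text \<open>Rows and columns label the steps of the boundary path, and each integer labels exactly
  one step: \<open>\<mu>\<^sub>i - i\<close> for a row or \<open>j - 1 - \<mu>'\<^sub>j\<close> for
  a column.\<close>

lemma maya_set_conjugate:
  assumes "is_partition \<mu>"
  shows "- 1 - k \<in> maya_set (conjugate \<mu>) \<longleftrightarrow> k \<notin> maya_set \<mu>"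
proof
  assume "- 1 - k \<in> maya_set (conjugate \<mu>)"
  then obtain j where j: "1 \<le> j" "- 1 - k = int (part (conjugate \<mu>) j) - int j"
    by (auto simp: maya_set_def)
  then have "k = int j - 1 - int (part (conjugate \<mu>) j)" by simp
  then show "k \<notin> maya_set \<mu>"
    using part_content_less_iff(2)[OF assms _ j(1)] by (auto simp: maya_set_def)
next
  assume k: "k \<notin> maya_set \<mu>"
  \<comment> \<open>In the first row whose label falls below \<open>k\<close>, column
    \<open>j = k + i\<close> is just missed, while row \<open>i - 1\<close>, if there is one, still
    reaches it. So this column has height \<open>i - 1\<close>.\<close>
  define i where "i = (LEAST i. 1 \<le> i \<and> int (part \<mu> i) - int i < k)"
  have "\<exists>i\<ge>1. int (part \<mu> i) - int i < k"
    by (intro exI[of _ "Suc (length \<mu> + nat (- k))"]) (auto simp: part_beyond)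
  then have i: "1 \<le> i" "int (part \<mu> i) - int i < k"
    unfolding i_def by (smt (verit, best) LeastI_ex)+
  define j where "j = nat (k + int i)"
  have j: "int j = k + int i" "1 \<le> j" using i by (auto simp: j_def)
  have "part (conjugate \<mu>) j < i"
    using le_part_conjugate_iff[OF assms i(1) j(2)] i(2) j(1) by linarith
  moreover have "i - 1 \<le> part (conjugate \<mu>) j"
  proof (cases "i = 1")
    case False
    then have "1 \<le> i - 1" using i(1) by simp
    moreover from this have "\<not> int (part \<mu> (i - 1)) - int (i - 1) < k"
      using not_less_Least[of "i - 1" "\<lambda>i. 1 \<le> i \<and> int (part \<mu> i) - int i < k"] i_def by auto
    moreover from \<open>1 \<le> i - 1\<close> have "int (part \<mu> (i - 1)) - int (i - 1) \<noteq> k"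
      using k maya_setI[of "i - 1" \<mu>] by metis
    ultimately show ?thesis
      using le_part_conjugate_iff[OF assms, of "i - 1" j] j by auto
  qed simp
  ultimately have "int (part (conjugate \<mu>) j) = int i - 1" using i(1) by linarith
  then have "- 1 - k = int (part (conjugate \<mu>) j) - int j" using j(1) by simp
  then show "- 1 - k \<in> maya_set (conjugate \<mu>)" using j(2) by (auto simp: maya_set_def)
qed

text \<open>The labels decrease strictly, so row \<open>i\<close> is the \<open>i\<close>-th largest
  element of the set. The one-sided estimate \<open>le\<close> is used in both directions.\<close>

lemma maya_set_inject:
  assumes "is_partition \<mu>" "is_partition \<nu>" "maya_set \<mu> = maya_set \<nu>"
  shows "\<mu> = \<nu>"
proof -
  have le: "int (part \<mu> i) - int i \<le> int (part \<nu> i) - int i"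
    if par: "is_partition \<mu>" "is_partition \<nu>" and sets: "maya_set \<mu> = maya_set \<nu>" and i: "1 \<le> i"
      and eq: "\<And>k. 1 \<le> k \<Longrightarrow> k < i \<Longrightarrow> part \<mu> k = part \<nu> k" for \<mu> \<nu> i
  proof -
    have "int (part \<mu> i) - int i \<in> maya_set \<nu>" using maya_setI[OF i, of \<mu>] sets by simp
    then obtain k where k: "1 \<le> k" "int (part \<mu> i) - int i = int (part \<nu> k) - int k"
      by (rule maya_setE)
    have "i \<le> k"
    proof (rule ccontr)
      assume "\<not> i \<le> k"
      then have "int (part \<mu> i) - int i = int (part \<mu> k) - int k" using eq[of k] k by linarith
      then show False using part_content_inject[OF par(1) i k(1)] \<open>\<not> i \<le> k\<close> by blast
    qed
    then show ?thesis
      using k(2) part_content_strict[OF par(2) i, of k] by (cases "i = k") auto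
  qed
  have eq: "part \<mu> i = part \<nu> i" if "1 \<le> i" for i
    using that
  proof (induction i rule: less_induct)
    case (less i)
    then show ?case
      using le[OF assms less.prems] le[OF assms(2,1) assms(3)[symmetric] less.prems] by fastforce
  qed
  have "i \<le> length \<mu> \<longleftrightarrow> i \<le> length \<nu>" if "1 \<le> i" for i
    using part_pos_iff[OF assms(1) that] part_pos_iff[OF assms(2) that] eq[OF that] by simp
  from this[of "length \<mu>"] this[of "length \<nu>"] have "length \<mu> = length \<nu>"
    by (cases "length \<mu>"; cases "length \<nu>") auto
  moreover have "\<mu> ! k = \<nu> ! k" if "k < length \<mu>" for k
    using eq[of "Suc k"] that \<open>length \<mu> = length \<nu>\<close> by (simp add: part_Suc)
  ultimately show ?thesis by (rule nth_equalityI)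
qed

lemma finite_maya_set_nonneg: "finite (maya_set \<mu> \<inter> {0..})"
proof (rule finite_subset)
  show "maya_set \<mu> \<inter> {0..} \<subseteq> (\<lambda>i. int (part \<mu> i) - int i) ` {1..length \<mu>}"
  proof
    fix k assume "k \<in> maya_set \<mu> \<inter> {0..}"
    then obtain i where i: "1 \<le> i" "k = int (part \<mu> i) - int i" "0 \<le> k" by (auto simp: maya_set_def)
    then have "i \<le> length \<mu>" using part_beyond[of \<mu> i] by (cases "i \<le> length \<mu>") auto
    then show "k \<in> (\<lambda>i. int (part \<mu> i) - int i) ` {1..length \<mu>}" using i by auto
  qed
qed simp

lemma SC_iff: "\<mu> \<in> SC \<longleftrightarrow> is_partition \<mu> \<and> maya_set \<mu> \<in> sym_sets"
proof (cases "is_partition \<mu>")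
  case True
  have "conjugate \<mu> = \<mu> \<longleftrightarrow> maya_set (conjugate \<mu>) = maya_set \<mu>"
    using maya_set_inject[OF is_partition_conjugate[OF True] True] by auto
  also have "\<dots> \<longleftrightarrow> (\<forall>k. - 1 - k \<in> maya_set (conjugate \<mu>) \<longleftrightarrow> - 1 - k \<in> maya_set \<mu>)"
  proof
    assume *: "\<forall>k. - 1 - k \<in> maya_set (conjugate \<mu>) \<longleftrightarrow> - 1 - k \<in> maya_set \<mu>"
    show "maya_set (conjugate \<mu>) = maya_set \<mu>"
    proof (rule set_eqI)
      fix k show "k \<in> maya_set (conjugate \<mu>) \<longleftrightarrow> k \<in> maya_set \<mu>"
        using *[rule_format, of "- 1 - k"] by simp
    qed
  qed simp
  also have "\<dots> \<longleftrightarrow> maya_set \<mu> \<in> sym_sets"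
    using finite_maya_set_nonneg by (auto simp: maya_set_conjugate[OF True] sym_sets_def)
  finally show ?thesis using True by (simp add: SC_def)
qed (simp add: SC_def)

section \<open>The partition of a symmetric set\<close>

text \<open>A strictly decreasing integer list drops by at least 1 per step, which the added index
  makes up for. The shifted entries become the parts.\<close>

lemma sorted_desc_shift:
  fixes xs :: "int list"
  assumes "sorted_wrt (>) xs" "i \<le> j" "j < length xs"
  shows "xs ! j + int j \<le> xs ! i + int i"
  using assms(2,3)
proof (induction j rule: dec_induct)
  case (step j)
  have "xs ! Suc j < xs ! j" using sorted_wrt_nth_less[OF assms(1), of j "Suc j"] step by simp
  then show ?case using step by simp
qed simp

lemma part_Cons: "part (x # xs) i = (if i = 1 then x else part xs (i - 1))"
  by (cases i) (auto simp: part_def nth_Cons split: nat.split)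

text \<open>In a nonincreasing list the zeros come last, so removing them moves no other
  entry.\<close>

lemma part_filter_pos:
  "sorted_wrt (\<ge>) xs \<Longrightarrow> 1 \<le> i \<Longrightarrow> part (filter (\<lambda>x. 0 < x) xs) i = part xs i"
proof (induction xs arbitrary: i)
  case (Cons x xs)
  show ?case
  proof (cases "0 < x")
    case True
    then show ?thesis using Cons by (auto simp: part_Cons)
  next
    case False
    then have z: "\<forall>y\<in>set (x # xs). y = 0" using Cons.prems by auto
    then have f: "filter (\<lambda>x. 0 < x) (x # xs) = []" by (auto simp: filter_empty_conv)
    have "part (x # xs) i = 0"
    proof (cases "i \<le> length (x # xs)")
      case True
      then have "(x # xs) ! (i - 1) \<in> set (x # xs)" using Cons.prems(2) by (intro nth_mem) auto
      then show ?thesis using z unfolding part_def by metis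
    qed (simp add: part_def)
    then show ?thesis unfolding f by (simp add: part_def)
  qed
qed simp

text \<open>Being a \<open>maya_set\<close> requires charge 0, that is, exactly \<open>N\<close>
  elements from \<open>- N\<close> upwards for large \<open>N\<close>. Symmetry provides this;
  sorting these elements and adding the row index yields the parts.\<close>

lemma ex_partition_maya_set:
  assumes S: "S \<in> sym_sets"
  obtains \<mu> where "is_partition \<mu>" "maya_set \<mu> = S"
proof -
  have fin: "finite (S \<inter> {0..})" using S by (simp add: sym_sets_def)
  then obtain m where m: "\<forall>k\<in>S \<inter> {0..}. k \<le> m"
    by (metis bdd_above.E bdd_above_finite)
  define N where "N = nat (max 0 m + 1)"
  have up: "k < int N" if "k \<in> S" for k
    using m that by (cases "0 \<le> k") (force simp: N_def)+
  have low: "k \<in> S" if "k < - int N" for k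
    using up[of "- 1 - k"] sym_setsD[OF S, of k] that by auto
  define C where "C = S \<inter> {- int N..}"
  \<comment> \<open>Negative elements of the window are mirror images of nonnegative holes, so the
    window has as many elements as \<open>{0..<N}\<close>.\<close>
  have C: "C = (S \<inter> {0..}) \<union> (\<lambda>k. - 1 - k) ` ({0..<int N} - S)"
  proof (rule set_eqI)
    fix k
    have "k \<in> (\<lambda>k. - 1 - k) ` ({0..<int N} - S) \<longleftrightarrow> - 1 - k \<in> {0..<int N} - S"
      by (auto intro!: image_eqI[of k _ "- 1 - k"])
    then show "k \<in> C \<longleftrightarrow> k \<in> (S \<inter> {0..}) \<union> (\<lambda>k. - 1 - k) ` ({0..<int N} - S)"
      using sym_setsD[OF S, of k] by (auto simp: C_def)
  qed
  then have finC: "finite C" using fin by simp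
  have "card C = card (S \<inter> {0..}) + card ({0..<int N} - S)"
    unfolding C using fin by (subst card_Un_disjoint) (auto simp: card_image inj_on_def)
  also have "S \<inter> {0..} = {0..<int N} \<inter> S" using up by auto
  finally have cardC: "card C = N" using card_Int_Diff[of "{0..<int N}" S] by simp
  define xs where "xs = rev (sorted_list_of_set C)"
  have len: "length xs = N" and set: "set xs = C"
    using finC cardC by (simp_all add: xs_def)
  have dec: "sorted_wrt (>) xs"
    unfolding xs_def sorted_wrt_rev using strict_sorted_list_of_set[of C] by simp
  \<comment> \<open>The smallest of the \<open>N\<close> entries is at least \<open>- N\<close>, so
    the last part is nonnegative, and with it all earlier ones.\<close>
  have ge: "0 \<le> xs ! i + int i + 1" if "i < N" for i
  proof -
    have "xs ! (N - 1) \<in> C" using that len set by (metis diff_less less_nat_zero_code nth_mem not_gr_zero zero_less_one)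
    then have "- int N \<le> xs ! (N - 1)" by (simp add: C_def)
    moreover have "xs ! (N - 1) + int (N - 1) \<le> xs ! i + int i"
      by (rule sorted_desc_shift[OF dec]) (use that len in auto)
    ultimately show ?thesis using that by simp
  qed
  define \<nu> where "\<nu> = map (\<lambda>i. nat (xs ! i + int i + 1)) [0..<N]"
  have sort: "sorted_wrt (\<ge>) \<nu>"
    unfolding sorted_wrt_iff_nth_less \<nu>_def using sorted_desc_shift[OF dec] len by (auto intro!: nat_mono)
  define \<mu> where "\<mu> = filter (\<lambda>x. 0 < x) \<nu>"
  have "is_partition \<mu>"
    using sort by (auto simp: is_partition_def \<mu>_def sorted_wrt_filter)
  moreover have part: "int (part \<mu> i) - int i = (if i \<le> N then xs ! (i - 1) else - int i)" if "1 \<le> i" for i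
  proof -
    have "part \<mu> i = part \<nu> i" unfolding \<mu>_def by (rule part_filter_pos[OF sort that])
    then show ?thesis using that ge[of "i - 1"] by (auto simp: part_def \<nu>_def)
  qed
  have "maya_set \<mu> = S"
  proof (intro equalityI subsetI)
    fix k assume "k \<in> maya_set \<mu>"
    then obtain i where i: "1 \<le> i" "k = int (part \<mu> i) - int i" by (auto simp: maya_set_def)
    show "k \<in> S"
    proof (cases "i \<le> N")
      case True
      then have "k \<in> set xs" using i part len by auto
      then show ?thesis by (simp add: set C_def)
    next
      case False
      then show ?thesis using i part low by simp
    qed
  next
    fix k assume k: "k \<in> S"
    show "k \<in> maya_set \<mu>"
    proof (cases "k < - int N")
      case True
      then have "1 \<le> nat (- k)" "k = int (part \<mu> (nat (- k))) - int (nat (- k))"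
        using part[of "nat (- k)"] by auto
      then show ?thesis unfolding maya_set_def by blast
    next
      case False
      then have "k \<in> set xs" using k by (simp add: set C_def)
      then obtain i where "i < N" "k = xs ! i" using len by (auto simp: in_set_conv_nth)
      then have "k = int (part \<mu> (Suc i)) - int (Suc i)" using part[of "Suc i"] by simp
      then show ?thesis unfolding maya_set_def by force
    qed
  qed
  ultimately show ?thesis using that by blast
qed

lemma bij_betw_maya_set: "bij_betw maya_set SC sym_sets"
  unfolding bij_betw_def
proof
  show "inj_on maya_set SC"
    by (auto simp: inj_on_def SC_iff intro: maya_set_inject)
  show "maya_set ` SC = sym_sets"
  proof (intro equalityI subsetI)
    fix S assume "S \<in> sym_sets"
    then obtain \<mu> where "is_partition \<mu>" "maya_set \<mu> = S" using ex_partition_maya_set by blast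
    then show "S \<in> maya_set ` SC" using \<open>S \<in> sym_sets\<close> by (auto simp: SC_iff)
  qed (auto simp: SC_iff)
qed

section \<open>Hooks, size and BG-rank read off the Maya diagram\<close>

text \<open>A row gives an element and a column a hole, by \<open>maya_set_conjugate\<close>. They
  meet in a box exactly when the hole is the smaller one, and their difference is then the hook
  length.\<close>

lemma bij_betw_hooks:
  assumes "is_partition \<mu>"
  shows "bij_betw (\<lambda>(i, j). (int (part \<mu> i) - int i, int j - 1 - int (part (conjugate \<mu>) j)))
    (diagram \<mu>) (hook_pairs (maya_set \<mu>))"
  unfolding bij_betw_def
proof
  let ?h = "\<lambda>(i, j). (int (part \<mu> i) - int i, int j - 1 - int (part (conjugate \<mu>) j))"
  show "inj_on ?h (diagram \<mu>)"
  proof (rule inj_onI, clarify)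
    fix i j k l assume "(i, j) \<in> diagram \<mu>" "(k, l) \<in> diagram \<mu>"
      "int (part \<mu> i) - int i = int (part \<mu> k) - int k"
      "int j - 1 - int (part (conjugate \<mu>) j) = int l - 1 - int (part (conjugate \<mu>) l)"
    then show "i = k \<and> j = l"
      using part_content_inject[OF assms, of i k]
        part_content_inject[OF is_partition_conjugate[OF assms], of j l]
      by (simp add: diagram_iff)
  qed
  have compl: "int j - 1 - int (part (conjugate \<mu>) j) \<notin> maya_set \<mu>" if "1 \<le> j" for j
    using part_content_less_iff(2)[OF assms _ that] by (auto simp: maya_set_def)
  show "?h ` diagram \<mu> = hook_pairs (maya_set \<mu>)"
  proof (intro equalityI subsetI)
    fix p assume "p \<in> ?h ` diagram \<mu>"
    then obtain i j where p: "p = ?h (i, j)" "1 \<le> i" "1 \<le> j" "j \<le> part \<mu> i"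
      by (auto simp: diagram_iff)
    then have "int (part \<mu> i) - int i \<in> maya_set \<mu>" by (auto simp: maya_set_def)
    then show "p \<in> hook_pairs (maya_set \<mu>)"
      using p compl[OF p(3)] part_content_less_iff(1)[OF assms p(2,3)] by (simp add: hook_pairs_def)
  next
    fix p assume "p \<in> hook_pairs (maya_set \<mu>)"
    then obtain a b where p: "p = (a, b)" "a \<in> maya_set \<mu>" "b \<notin> maya_set \<mu>" "b < a"
      by (auto simp: hook_pairs_def)
    obtain i where i: "1 \<le> i" "a = int (part \<mu> i) - int i" using p(2) by (auto simp: maya_set_def)
    have "- 1 - b \<in> maya_set (conjugate \<mu>)" using p(3) maya_set_conjugate[OF assms] by simp
    then obtain j where j: "1 \<le> j" "- 1 - b = int (part (conjugate \<mu>) j) - int j"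
      by (auto simp: maya_set_def)
    have b: "b = int j - 1 - int (part (conjugate \<mu>) j)" using j(2) by simp
    have "(i, j) \<in> diagram \<mu>"
      using part_content_less_iff(1)[OF assms i(1) j(1)] p(4) i j(1) b by (simp add: diagram_iff)
    then show "p \<in> ?h ` diagram \<mu>" using p(1) i(2) b by (intro image_eqI[of _ _ "(i, j)"]) auto
  qed
qed

lemma prod_hooks_div:
  fixes g :: "nat \<Rightarrow> 'c::comm_monoid_mult"
  assumes "is_partition \<mu>"
  shows "(\<Prod>h\<in>#hooks_div t \<mu>. g h)
    = (\<Prod>(a, b)\<in>{(a, b) \<in> hook_pairs (maya_set \<mu>). int t dvd a - b}. g (nat (a - b)))"
proof -
  let ?h = "\<lambda>(i, j). (int (part \<mu> i) - int i, int j - 1 - int (part (conjugate \<mu>) j))"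
  have len: "int (hook_length \<mu> p) = fst (?h p) - snd (?h p)" if "p \<in> diagram \<mu>" for p
  proof -
    obtain i j where ij: "p = (i, j)" by (cases p)
    with that have p: "p = (i, j)" "1 \<le> i" "1 \<le> j" "j \<le> part \<mu> i"
      by (auto simp: diagram_iff)
    then have "i \<le> part (conjugate \<mu>) j" using le_part_conjugate_iff[OF assms] by simp
    then show ?thesis using p by (simp add: hook_length_def)
  qed
  have bij: "bij_betw ?h {p \<in> diagram \<mu>. t dvd hook_length \<mu> p}
      {(a, b) \<in> hook_pairs (maya_set \<mu>). int t dvd a - b}"
    unfolding bij_betw_def
  proof
    show "inj_on ?h {p \<in> diagram \<mu>. t dvd hook_length \<mu> p}"
      using bij_betw_hooks[OF assms] by (rule bij_betw_imp_inj_on[THEN inj_on_subset]) auto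
    have d: "t dvd hook_length \<mu> p \<longleftrightarrow> int t dvd fst (?h p) - snd (?h p)" if "p \<in> diagram \<mu>" for p
      using len[OF that] by (metis of_nat_dvd_iff)
    have "{(a, b) \<in> hook_pairs (maya_set \<mu>). int t dvd a - b}
        = {q \<in> ?h ` diagram \<mu>. int t dvd fst q - snd q}"
      using bij_betw_imp_surj_on[OF bij_betw_hooks[OF assms]] by auto
    then show "?h ` {p \<in> diagram \<mu>. t dvd hook_length \<mu> p}
        = {(a, b) \<in> hook_pairs (maya_set \<mu>). int t dvd a - b}"
      using d by (simp only:) blast
  qed
  have "(\<Prod>h\<in>#hooks_div t \<mu>. g h) = (\<Prod>p\<in>{p \<in> diagram \<mu>. t dvd hook_length \<mu> p}. g (hook_length \<mu> p))"
    unfolding hooks_div_def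
    by (simp add: prod_unfold_prod_mset filter_mset_image_mset filter_mset_mset_set finite_diagram
        image_mset.compositionality comp_def)
  also have "\<dots> = (\<Prod>p\<in>{p \<in> diagram \<mu>. t dvd hook_length \<mu> p}. case ?h p of (a, b) \<Rightarrow> g (nat (a - b)))"
  proof (rule prod.cong[OF refl])
    fix p assume "p \<in> {p \<in> diagram \<mu>. t dvd hook_length \<mu> p}"
    then have "hook_length \<mu> p = nat (fst (?h p) - snd (?h p))" using len[of p] by simp
    then show "g (hook_length \<mu> p) = (case ?h p of (a, b) \<Rightarrow> g (nat (a - b)))"
      by (cases p) simp
  qed
  also have "\<dots> = (\<Prod>(a, b)\<in>{(a, b) \<in> hook_pairs (maya_set \<mu>). int t dvd a - b}. g (nat (a - b)))"
    by (rule prod.reindex_bij_betw[OF bij])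
  finally show ?thesis .
qed

text \<open>The diagram is cut into its hooks at the diagonal boxes. Arm and leg of such a hook are
  both \<open>k = \<mu>\<^sub>i - i\<close>, so distance 0 occurs once and each distance from 1 to
  \<open>k\<close> twice. Size and BG-rank are two choices of \<open>g\<close>.\<close>

lemma sum_diagram_SC:
  fixes g :: "int \<Rightarrow> int"
  assumes "\<mu> \<in> SC"
  shows "(\<Sum>(i, j)\<in>diagram \<mu>. g \<bar>int i - int j\<bar>)
    = (\<Sum>k\<in>maya_set \<mu> \<inter> {0..}. g 0 + 2 * (\<Sum>c\<in>{1..k}. g c))"
proof -
  have par: "is_partition \<mu>" and conj: "conjugate \<mu> = \<mu>" using assms by (auto simp: SC_def)
  have sym: "(i, j) \<in> diagram \<mu> \<longleftrightarrow> (j, i) \<in> diagram \<mu>" for i j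
    using le_part_conjugate_iff[OF par, of i j] by (auto simp: diagram_iff conj)
  let ?f = "\<lambda>(i, j). g \<bar>int i - int j\<bar>"
  let ?D = "{(i, j) \<in> diagram \<mu>. i = j}" and ?U = "{(i, j) \<in> diagram \<mu>. i < j}"
    and ?L = "{(i, j) \<in> diagram \<mu>. j < i}"
  have fin: "finite ?D" "finite ?U" "finite ?L"
    using finite_diagram[of \<mu>] by (auto elim: rev_finite_subset)
  have "diagram \<mu> = ?D \<union> (?U \<union> ?L)" by auto
  then have "sum ?f (diagram \<mu>) = sum ?f (?D \<union> (?U \<union> ?L))" by simp
  also have "\<dots> = sum ?f ?D + (sum ?f ?U + sum ?f ?L)"
    using fin by (subst sum.union_disjoint; auto)+
  also have "sum ?f ?L = sum ?f ?U"
    by (rule sum.reindex_bij_witness[of _ prod.swap prod.swap]) (use sym in \<open>auto simp: abs_minus_commute\<close>)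
  also have "sum ?f ?D + (sum ?f ?U + sum ?f ?U) = sum ?f ?D + (\<Sum>p\<in>?U. 2 * ?f p)"
    by (simp add: sum_distrib_left[symmetric])
  also have "\<dots> = (\<Sum>(i, j)\<in>?D \<union> ?U. if i = j then g 0 else 2 * g (int j - int i))"
    using fin by (subst sum.union_disjoint) (auto intro!: arg_cong2[of _ _ _ _ "(+)"] sum.cong)
  also have "?D \<union> ?U = (SIGMA i:{i. 1 \<le> i \<and> i \<le> part \<mu> i}. {i..part \<mu> i})"
    by (auto simp: diagram_iff)
  also have "(\<Sum>(i, j)\<in>(SIGMA i:{i. 1 \<le> i \<and> i \<le> part \<mu> i}. {i..part \<mu> i}). if i = j then g 0 else 2 * g (int j - int i))
      = (\<Sum>i\<in>{i. 1 \<le> i \<and> i \<le> part \<mu> i}. \<Sum>j\<in>{i..part \<mu> i}. if i = j then g 0 else 2 * g (int j - int i))"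
  proof (rule sum.Sigma[symmetric])
    have "{i. 1 \<le> i \<and> i \<le> part \<mu> i} \<subseteq> {..length \<mu>}"
      using part_beyond[of \<mu>] by (auto simp: not_less[symmetric])
    then show "finite {i. 1 \<le> i \<and> i \<le> part \<mu> i}" by (rule finite_subset) simp
  qed simp
  also have "\<dots> = (\<Sum>i\<in>{i. 1 \<le> i \<and> i \<le> part \<mu> i}.
      g 0 + 2 * (\<Sum>c\<in>{1..int (part \<mu> i) - int i}. g c))"
  proof (rule sum.cong[OF refl])
    fix i assume "i \<in> {i. 1 \<le> i \<and> i \<le> part \<mu> i}"
    then have "{i..part \<mu> i} = insert i {Suc i..part \<mu> i}" by auto
    then have "(\<Sum>j\<in>{i..part \<mu> i}. if i = j then g 0 else 2 * g (int j - int i))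
        = g 0 + (\<Sum>j\<in>{Suc i..part \<mu> i}. 2 * g (int j - int i))"
      by (simp only: sum.insert finite_atLeastAtMost) (auto intro!: sum.cong)
    also have "(\<Sum>j\<in>{Suc i..part \<mu> i}. 2 * g (int j - int i)) = (\<Sum>c\<in>{1..int (part \<mu> i) - int i}. 2 * g c)"
      by (rule sum.reindex_bij_witness[of _ "\<lambda>c. nat (c + int i)" "\<lambda>j. int j - int i"]) auto
    finally show "(\<Sum>j\<in>{i..part \<mu> i}. if i = j then g 0 else 2 * g (int j - int i))
        = g 0 + 2 * (\<Sum>c\<in>{1..int (part \<mu> i) - int i}. g c)"
      by (simp add: sum_distrib_left)
  qed
  also have "\<dots> = (\<Sum>k\<in>maya_set \<mu> \<inter> {0..}. g 0 + 2 * (\<Sum>c\<in>{1..k}. g c))"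
  proof (rule sum.reindex_bij_betw)
    show "bij_betw (\<lambda>i. int (part \<mu> i) - int i) {i. 1 \<le> i \<and> i \<le> part \<mu> i} (maya_set \<mu> \<inter> {0..})"
      unfolding bij_betw_def using part_content_inject[OF par]
      by (auto simp: inj_on_def maya_set_def)
  qed
  finally show ?thesis .
qed

lemma size_SC:
  assumes "\<mu> \<in> SC"
  shows "int (sum_list \<mu>) = (\<Sum>k\<in>maya_set \<mu> \<inter> {0..}. 2 * k + 1)"
proof -
  have "diagram \<mu> = (SIGMA i:{1..length \<mu>}. {1..part \<mu> i})"
    by (auto simp: diagram_def)
  then have "(\<Sum>(i, j)\<in>diagram \<mu>. 1) = int (\<Sum>i\<in>{1..length \<mu>}. part \<mu> i)"
    by (simp add: split_def)
  also have "(\<Sum>i\<in>{1..length \<mu>}. part \<mu> i) = (\<Sum>i\<in>{0..<length \<mu>}. \<mu> ! i)"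
    by (rule sum.reindex_bij_witness[of _ Suc "\<lambda>i. i - 1"]) (auto simp: part_def)
  also have "\<dots> = sum_list \<mu>" by (simp add: sum_list_sum_nth)
  finally show ?thesis
    using sum_diagram_SC[OF assms, of "\<lambda>_. 1"] by (simp add: algebra_simps)
qed

lemma alt_sign_mirror: "alt_sign (- 1 - k) = - alt_sign k"
  by (simp add: alt_sign_def)

lemma sum_alt_sign:
  assumes "0 \<le> k"
  shows "1 + 2 * (\<Sum>c\<in>{1..k}. alt_sign c) = alt_sign k"
  using assms
proof (induction k rule: int_ge_induct)
  case (step k)
  have "{1..k + 1} = insert (k + 1) {1..k}" using step by auto
  then show ?case using step by (simp add: alt_sign_def)
qed (simp add: alt_sign_def)

lemma BG_rank_SC:
  assumes "\<mu> \<in> SC"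
  shows "BG_rank \<mu> = (\<Sum>k\<in>maya_set \<mu> \<inter> {0..}. alt_sign k)"
proof -
  have "BG_rank \<mu> = (\<Sum>(i, j)\<in>diagram \<mu>. alt_sign \<bar>int i - int j\<bar>)"
    unfolding BG_rank_def by (rule sum.cong) (auto simp: alt_sign_def minus_one_power_iff)
  also have "\<dots> = (\<Sum>k\<in>maya_set \<mu> \<inter> {0..}. alt_sign 0 + 2 * (\<Sum>c\<in>{1..k}. alt_sign c))"
    by (rule sum_diagram_SC[OF assms])
  also have "\<dots> = (\<Sum>k\<in>maya_set \<mu> \<inter> {0..}. alt_sign k)"
    by (rule sum.cong) (use sum_alt_sign in \<open>auto simp: alt_sign_def[of 0]\<close>)
  finally show ?thesis .
qed

section \<open>Evaluation\<close>

definition sym_size :: "int set \<Rightarrow> nat" where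
  "sym_size S = nat (\<Sum>k\<in>S \<inter> {0..}. 2 * k + 1)"

definition sym_BG :: "int set \<Rightarrow> int" where
  "sym_BG S = (\<Sum>k\<in>S \<inter> {0..}. alt_sign k)"

lemma int_slice_size: "r < t \<Longrightarrow> int (slice_size t r M) = normal_sum (\<lambda>m. 2 * (int r + int t * m) + 1) M"
proof -
  assume r: "r < t"
  have "2 * (int r + int t * m) + 1 \<ge> 0" if "0 \<le> m" for m using that by simp
  moreover have "2 * (int r + int t * m) + 1 \<le> 0" if "m < 0" for m
  proof -
    have "int t * m \<le> int t * (- 1)" using that by (intro mult_left_mono) auto
    then show ?thesis using r by simp
  qed
  ultimately have "0 \<le> normal_sum (\<lambda>m. 2 * (int r + int t * m) + 1) M"
    unfolding normal_sum_def by (smt (verit) sum_nonneg sum_nonpos IntD2 DiffD1 atLeast_iff lessThan_iff)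
  then show ?thesis by (simp add: slice_size_def)
qed

lemma sym_size_slices:
  assumes "S \<in> sym_sets" "even t" "t > 0"
  shows "sym_size S = (\<Sum>r<t div 2. slice_size t r (slice t S r))"
proof -
  have "(\<Sum>k\<in>S \<inter> {0..}. 2 * k + 1) = (\<Sum>r<t div 2. normal_sum (\<lambda>m. 2 * (int r + int t * m) + 1) (slice t S r))"
    by (rule sum_sym_set[OF assms]) simp
  also have "\<dots> = int (\<Sum>r<t div 2. slice_size t r (slice t S r))"
    using assms(2,3) by (simp add: int_slice_size)
  finally show ?thesis unfolding sym_size_def by (simp only: nat_int)
qed

text \<open>For even \<open>t\<close> the sign is constant on a residue class, so a slice enters
  only through its charge.\<close>

lemma sym_BG_slices:
  assumes "S \<in> sym_sets" "even t" "t > 0"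
  shows "sym_BG S = (\<Sum>r<t div 2. alt_sign (int r) * charge (slice t S r))"
proof -
  have "sym_BG S = (\<Sum>r<t div 2. normal_sum (\<lambda>m. alt_sign (int r + int t * m)) (slice t S r))"
    unfolding sym_BG_def by (rule sum_sym_set[OF assms]) (rule alt_sign_mirror)
  moreover have "normal_sum (\<lambda>m. alt_sign (int r + int t * m)) M = alt_sign (int r) * charge M" for r M
  proof -
    have "alt_sign (int r + int t * m) = alt_sign (int r)" for m
      using assms(2) by (simp add: alt_sign_def)
    then show ?thesis by (simp add: normal_sum_def charge_def algebra_simps)
  qed
  ultimately show ?thesis by simp
qed

text \<open>The weight \<open>g\<close> is kept arbitrary: squared hook weights give the wanted
  series and \<open>g = 1\<close> the comparison series, with the same product over the
  charges.\<close>

lemma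
  fixes g :: "int \<Rightarrow> coeff_ring"
  assumes t: "even t" "t > 0"
  shows finite_fibres_sym_sets: "finite_fibres sym_sets sym_size"
    and gf_sym_sets: "gf sym_sets sym_size
        (\<lambda>S. b_pow (sym_BG S) * (\<Prod>r<t div 2. \<Prod>(a, b)\<in>hook_pairs (slice t S r). g (a - b)))
      = (\<Prod>r<t div 2. gf UNIV (charge_size t r) (\<lambda>c. b_pow (alt_sign (int r) * c)))
        * gf UNIV (\<lambda>n. 2 * t * n) (\<lambda>n. \<Sum>B\<in>beta_sets n n. \<Prod>(a, b)\<in>beta_pairs B. g (int a - int b)) ^ (t div 2)"
proof -
  let ?I = "{..<t div 2}"
  let ?h = "\<lambda>S. restrict (slice t S) ?I"
  let ?w = "\<lambda>r M. b_pow (alt_sign (int r) * charge M) * (\<Prod>(a, b)\<in>hook_pairs M. g (a - b))"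
  note bij = bij_betw_slice[OF t]
  have res: "r < t" if "r \<in> ?I" for r using that by auto
  have size: "(\<Sum>r\<in>?I. slice_size t r (?h S r)) = sym_size S" if "S \<in> sym_sets" for S
    using sym_size_slices[OF that t] by simp
  show "finite_fibres sym_sets sym_size"
    using finite_fibres_reindex[OF bij, where s' = "\<lambda>F. \<Sum>r\<in>?I. slice_size t r (F r)", OF size]
      finite_fibres_PiE[of ?I "\<lambda>_. {M. maya M}" "slice_size t"] finite_fibres_slice_size[OF res] by blast
  have "gf sym_sets sym_size
        (\<lambda>S. b_pow (sym_BG S) * (\<Prod>r<t div 2. \<Prod>(a, b)\<in>hook_pairs (slice t S r). g (a - b)))
      = gf (\<Pi>\<^sub>E r\<in>?I. {M. maya M}) (\<lambda>F. \<Sum>r\<in>?I. slice_size t r (F r)) (\<lambda>F. \<Prod>r\<in>?I. ?w r (F r))"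
  proof (rule gf_reindex[OF bij])
    fix S assume S: "S \<in> sym_sets"
    show "(\<Sum>r\<in>?I. slice_size t r (?h S r)) = sym_size S" by (rule size[OF S])
    show "(\<Prod>r\<in>?I. ?w r (?h S r))
        = b_pow (sym_BG S) * (\<Prod>r<t div 2. \<Prod>(a, b)\<in>hook_pairs (slice t S r). g (a - b))"
      by (simp add: sym_BG_slices[OF S t] b_pow_sum prod.distrib)
  qed
  also have "\<dots> = (\<Prod>r\<in>?I. gf {M. maya M} (slice_size t r) (?w r))"
    by (rule gf_PiE) (use finite_fibres_slice_size[OF res] in auto)
  also have "\<dots> = (\<Prod>r\<in>?I. gf UNIV (charge_size t r) (\<lambda>c. b_pow (alt_sign (int r) * c))
      * gf UNIV (\<lambda>n. 2 * t * n) (\<lambda>n. \<Sum>B\<in>beta_sets n n. \<Prod>(a, b)\<in>beta_pairs B. g (int a - int b)))"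
    by (rule prod.cong[OF refl]) (rule gf_slice[OF res])
  finally show "gf sym_sets sym_size
        (\<lambda>S. b_pow (sym_BG S) * (\<Prod>r<t div 2. \<Prod>(a, b)\<in>hook_pairs (slice t S r). g (a - b)))
      = (\<Prod>r<t div 2. gf UNIV (charge_size t r) (\<lambda>c. b_pow (alt_sign (int r) * c)))
        * gf UNIV (\<lambda>n. 2 * t * n) (\<lambda>n. \<Sum>B\<in>beta_sets n n. \<Prod>(a, b)\<in>beta_pairs B. g (int a - int b)) ^ (t div 2)"
    by (simp add: prod.distrib)
qed

text \<open>A symmetric set is an arbitrary finite set of nonnegative integers plus its forced
  negative half. An element \<open>2 j\<close> has size \<open>4 j + 1\<close> and sign 1, an
  element \<open>2 j + 1\<close> has size \<open>4 j + 3\<close> and sign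
  \<open>- 1\<close>.\<close>

lemma gf_sym_sets_qpoch:
  "gf sym_sets sym_size (\<lambda>S. b_pow (sym_BG S))
   = qpoch_inf (- (fps_const (b_pow 1) * fps_X)) (fps_X ^ 4)
     * qpoch_inf (- (fps_const (b_pow (- 1)) * fps_X ^ 3)) (fps_X ^ 4)"
proof -
  define T where "T = (\<lambda>(D, E). (\<lambda>j. 2 * int j) ` D \<union> (\<lambda>j. 2 * int j + 1) ` E)"
  define f where "f S = ({j. 2 * int j \<in> S}, {j. 2 * int j + 1 \<in> S})" for S
  define g where "g p = {k. if 0 \<le> k then k \<in> T p else - 1 - k \<notin> T p}" for p
  let ?F = "{D. finite D} :: nat set set"
  have parity: "\<exists>j. k = 2 * int j \<or> k = 2 * int j + 1" if "0 \<le> k" for k :: int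
  proof -
    have "k = 2 * (k div 2) \<or> k = 2 * (k div 2) + 1" by presburger
    moreover have "int (nat (k div 2)) = k div 2" using that by simp
    ultimately show ?thesis by metis
  qed
  have T_even: "2 * int j \<in> T (D, E) \<longleftrightarrow> j \<in> D" and T_odd: "2 * int j + 1 \<in> T (D, E) \<longleftrightarrow> j \<in> E" for j D E
    unfolding T_def by (auto simp: image_iff) presburger+
  have T_nonneg: "k \<in> T p \<Longrightarrow> 0 \<le> k" for k p by (auto simp: T_def split: prod.splits)
  have Tf: "T (f S) = S \<inter> {0..}" for S
  proof (rule set_eqI)
    fix k
    show "k \<in> T (f S) \<longleftrightarrow> k \<in> S \<inter> {0..}"
    proof (cases "0 \<le> k")
      case True
      then show ?thesis using parity[OF True] T_even T_odd by (auto simp: f_def)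
    qed (auto dest: T_nonneg)
  qed
  have bij: "bij_betw f sym_sets (?F \<times> ?F)"
  proof (rule bij_betwI[where g = g])
    show "f \<in> sym_sets \<rightarrow> ?F \<times> ?F"
    proof
      fix S assume "S \<in> sym_sets"
      then have fin: "finite (S \<inter> {0..})" by (simp add: sym_sets_def)
      have "finite {j. 2 * int j \<in> S}"
        by (rule inj_on_finite[OF _ _ fin, where f = "\<lambda>j. 2 * int j"]) (auto simp: inj_on_def)
      moreover have "finite {j. 2 * int j + 1 \<in> S}"
        by (rule inj_on_finite[OF _ _ fin, where f = "\<lambda>j. 2 * int j + 1"]) (auto simp: inj_on_def)
      ultimately show "f S \<in> ?F \<times> ?F" by (simp add: f_def)
    qed
    show "g \<in> ?F \<times> ?F \<rightarrow> sym_sets"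
    proof
      fix p assume p: "p \<in> ?F \<times> ?F"
      have "g p \<inter> {0..} = T p" by (auto simp: g_def dest: T_nonneg)
      moreover have "finite (T p)" using p by (auto simp: T_def)
      moreover have "- 1 - k \<in> g p \<longleftrightarrow> k \<notin> g p" for k by (auto simp: g_def)
      ultimately show "g p \<in> sym_sets" by (simp add: sym_sets_def)
    qed
    show "g (f S) = S" if "S \<in> sym_sets" for S
      using sym_setsD[OF that] by (auto simp: g_def Tf)
    show "f (g p) = p" if "p \<in> ?F \<times> ?F" for p
      by (cases p) (auto simp: f_def g_def T_even T_odd)
  qed
  have split: "(\<Sum>k\<in>S \<inter> {0..}. u k) = (\<Sum>j\<in>fst (f S). u (2 * int j)) + (\<Sum>j\<in>snd (f S). u (2 * int j + 1))"
    if "S \<in> sym_sets" for S and u :: "int \<Rightarrow> int"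
  proof -
    have fin: "finite (fst (f S))" "finite (snd (f S))"
      using bij_betwE[OF bij] that by (auto simp: mem_Times_iff)
    have "S \<inter> {0..} = (\<lambda>j. 2 * int j) ` fst (f S) \<union> (\<lambda>j. 2 * int j + 1) ` snd (f S)"
      unfolding Tf[symmetric] T_def by (simp add: split_def)
    moreover have "(\<lambda>j. 2 * int j) ` A \<inter> (\<lambda>j. 2 * int j + 1) ` B = {}" for A B
      by auto presburger
    moreover have "inj_on (\<lambda>j. 2 * int j) A" "inj_on (\<lambda>j. 2 * int j + 1) A" for A by (auto simp: inj_on_def)
    ultimately show ?thesis
      using fin by (simp add: sum.union_disjoint sum.reindex)
  qed
  have "gf sym_sets sym_size (\<lambda>S. b_pow (sym_BG S))
      = gf (?F \<times> ?F) (\<lambda>(D, E). (\<Sum>d\<in>D. 4 * d + 1) + (\<Sum>d\<in>E. 4 * d + 3))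
          (\<lambda>(D, E). b_pow 1 ^ card D * b_pow (- 1) ^ card E)"
  proof (rule gf_reindex[OF bij])
    fix S assume S: "S \<in> sym_sets"
    have "(\<Sum>k\<in>S \<inter> {0..}. 2 * k + 1) = int ((\<Sum>d\<in>fst (f S). 4 * d + 1) + (\<Sum>d\<in>snd (f S). 4 * d + 3))"
      unfolding split[OF S] by (simp add: algebra_simps)
    then show "(case f S of (D, E) \<Rightarrow> (\<Sum>d\<in>D. 4 * d + 1) + (\<Sum>d\<in>E. 4 * d + 3)) = sym_size S"
      unfolding sym_size_def by (simp only: nat_int split_def)
    have "sym_BG S = int (card (fst (f S))) * 1 + int (card (snd (f S))) * (- 1)"
      unfolding sym_BG_def split[OF S] by (simp add: alt_sign_def)
    then show "(case f S of (D, E) \<Rightarrow> b_pow 1 ^ card D * b_pow (- 1) ^ card E) = b_pow (sym_BG S)"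
      by (simp only: b_pow_power b_pow_add split_def)
  qed
  also have "\<dots> = gf ?F (\<lambda>D. \<Sum>d\<in>D. 4 * d + 1) (\<lambda>D. b_pow 1 ^ card D)
      * gf ?F (\<lambda>D. \<Sum>d\<in>D. 4 * d + 3) (\<lambda>D. b_pow (- 1) ^ card D)"
    by (rule gf_times[symmetric]) (rule finite_fibres_finite_sets; simp)+
  finally show ?thesis
    using gf_finite_sets[of 4 1 "b_pow 1"] gf_finite_sets[of 4 3 "b_pow (- 1)"] by simp
qed

text \<open>One factor \<open>x / h\<close> per hook merges the power of \<open>x\<close> and the
  inverse hook product into a single product over hooks.\<close>

definition hook_weight :: "nat \<Rightarrow> coeff_ring" where
  "hook_weight h = x_var * scalar (1 / of_nat h)"

lemma prod_hook_weight:
  "(\<Prod>h\<in>#H. hook_weight h) = x_var ^ size H * scalar (\<Prod>h\<in>#H. 1 / of_nat h)"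
proof (induction H)
  case (add h H)
  have "scalar (\<Prod>h\<in>#add_mset h H. 1 / of_nat h) = scalar (1 / of_nat h) * scalar (\<Prod>h\<in>#H. 1 / of_nat h)"
    by (simp add: scalar_mult)
  with add show ?case by (simp only:) (simp add: hook_weight_def mult_ac)
qed simp

text \<open>A slice hook \<open>a - b\<close> has weight \<open>x / t\<close> times
  \<open>1 / (a - b)\<close>. Over \<open>n\<close> boxes this gives
  \<open>(x / t)\<^sup>2\<^sup>n\<close> times the squared \<open>beta_weight\<close>, and
  \<open>sum_beta_weight_square\<close> applies.\<close>

lemma gf_hook_weight:
  assumes t: "t > 0"
  shows "gf UNIV (\<lambda>n. 2 * t * n)
      (\<lambda>n. \<Sum>B\<in>beta_sets n n. \<Prod>(a, b)\<in>beta_pairs B. (hook_weight (nat (int t * (int a - int b))))\<^sup>2)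
    = exp_gf (2 * t) ((hook_weight t)\<^sup>2)"
proof -
  have w: "hook_weight (nat (int t * (int a - int b))) = hook_weight t * scalar (1 / (of_nat a - of_nat b))"
    if "b < a" for a b
  proof -
    have "int t * (int a - int b) = int (t * (a - b))" using that by simp
    then have "nat (int t * (int a - int b)) = t * (a - b)" by (simp only: nat_int)
    moreover have "of_nat (a - b) = (of_nat a - of_nat b :: rat)" using that by simp
    ultimately show ?thesis by (simp add: hook_weight_def mult.assoc scalar_mult)
  qed
  have "(\<Sum>B\<in>beta_sets n n. \<Prod>(a, b)\<in>beta_pairs B. (hook_weight (nat (int t * (int a - int b))))\<^sup>2)
      = scalar (1 / fact n) * (hook_weight t)\<^sup>2 ^ n" for n
  proof -
    have "(\<Prod>(a, b)\<in>beta_pairs B. (hook_weight (nat (int t * (int a - int b))))\<^sup>2)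
        = scalar ((beta_weight B)\<^sup>2) * (hook_weight t)\<^sup>2 ^ n" if B: "B \<in> beta_sets n n" for B
    proof -
      have "(\<Prod>(a, b)\<in>beta_pairs B. (hook_weight (nat (int t * (int a - int b))))\<^sup>2)
          = (\<Prod>(a, b)\<in>beta_pairs B. (hook_weight t)\<^sup>2 * (scalar (1 / (of_nat a - of_nat b)))\<^sup>2)"
        by (rule prod.cong) (auto simp: beta_pairs_def w power_mult_distrib)
      also have "\<dots> = (hook_weight t)\<^sup>2 ^ card (beta_pairs B)
          * (\<Prod>(a, b)\<in>beta_pairs B. scalar (1 / (of_nat a - of_nat b)))\<^sup>2"
        by (simp add: split_def prod.distrib prod_power_distrib)
      also have "(\<Prod>(a, b)\<in>beta_pairs B. scalar (1 / (of_nat a - of_nat b))) = scalar (beta_weight B)"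
        by (simp add: beta_weight_def beta_pairs_def scalar_prod split_def)
      also have "card (beta_pairs B) = n"
        using B beta_sets_iff_card_pairs[of B n n] by (simp add: beta_sets_def)
      finally show ?thesis by (simp add: scalar_power mult.commute)
    qed
    then show ?thesis
      by (simp add: scalar_sum[symmetric] sum_beta_weight_square flip: sum_distrib_right)
  qed
  then show ?thesis by (simp add: exp_gf_def)
qed

theorem corollary4p1:
  fixes t :: nat
  assumes "even t" and "t > 0"
  shows "((\<lambda>\<mu>. fps_X ^ sum_list \<mu> *
             fps_const (x_var ^ size (hooks_div t \<mu>) * b_pow (BG_rank \<mu>) *
               scalar (\<Prod>h\<in>#hooks_div t \<mu>. 1 / of_nat h)))
          has_sum
            (qpoch_inf (fps_X ^ (2 * t)) (fps_X ^ (2 * t)) ^ (t div 2) *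
             qpoch_inf (- (fps_const (b_pow 1) * fps_X)) (fps_X ^ 4) *
             qpoch_inf (- (fps_const (b_pow (- 1)) * fps_X ^ 3)) (fps_X ^ 4) *
             exp_series (fps_const (x_var ^ 2 * scalar (1 / (2 * of_nat t))) * fps_X ^ (2 * t))))
          SC"
proof -
  let ?w = "\<lambda>\<mu>. x_var ^ size (hooks_div t \<mu>) * b_pow (BG_rank \<mu>) *
               scalar (\<Prod>h\<in>#hooks_div t \<mu>. 1 / of_nat h)"
  let ?g = "\<lambda>k. (hook_weight (nat (int t * k)))\<^sup>2"
  let ?\<Theta> = "\<Prod>r<t div 2. gf UNIV (charge_size t r) (\<lambda>c. b_pow (alt_sign (int r) * c))"
  let ?P = "gf UNIV (\<lambda>n. 2 * t * n) (\<lambda>n. of_nat (card (beta_sets n n))) :: coeff_ring fps"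
  let ?Q = "qpoch_inf (fps_X ^ (2 * t)) (fps_X ^ (2 * t)) :: coeff_ring fps"
  let ?R = "qpoch_inf (- (fps_const (b_pow 1) * fps_X)) (fps_X ^ 4)
     * qpoch_inf (- (fps_const (b_pow (- 1)) * fps_X ^ 3)) (fps_X ^ 4)"
  have size: "sym_size (maya_set \<mu>) = sum_list \<mu>" if "\<mu> \<in> SC" for \<mu>
    using size_SC[OF that] by (simp add: sym_size_def flip: size_SC)
  have weight: "b_pow (sym_BG (maya_set \<mu>)) *
      (\<Prod>r<t div 2. \<Prod>(a, b)\<in>hook_pairs (slice t (maya_set \<mu>) r). ?g (a - b)) = ?w \<mu>" if "\<mu> \<in> SC" for \<mu>
  proof -
    have S: "maya_set \<mu> \<in> sym_sets" "is_partition \<mu>" using that by (auto simp: SC_iff)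
    have "(\<Prod>h\<in>#hooks_div t \<mu>. hook_weight h)
        = (\<Prod>r<t div 2. \<Prod>(a, b)\<in>hook_pairs (slice t (maya_set \<mu>) r). ?g (a - b))"
      unfolding prod_hooks_div[OF S(2)] by (rule prod_hook_pairs_sym_set[OF S(1) assms])
    note P = this[unfolded prod_hook_weight]
    show ?thesis
      unfolding P[symmetric] sym_BG_def BG_rank_SC[OF that] by (simp only: mult_ac)
  qed
  have "gf SC sum_list ?w = gf sym_sets sym_size
      (\<lambda>S. b_pow (sym_BG S) * (\<Prod>r<t div 2. \<Prod>(a, b)\<in>hook_pairs (slice t S r). ?g (a - b)))"
    by (rule gf_reindex[OF bij_betw_maya_set]) (rule size weight; assumption)+
  also have "\<dots> = ?\<Theta> * exp_gf (2 * t) ((hook_weight t)\<^sup>2) ^ (t div 2)"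
    using gf_sym_sets[OF assms, of ?g] unfolding gf_hook_weight[OF assms(2)] .
  also have "exp_gf (2 * t) ((hook_weight t)\<^sup>2) ^ (t div 2)
      = exp_series (fps_const (x_var ^ 2 * scalar (1 / (2 * of_nat t))) * fps_X ^ (2 * t))"
  proof -
    obtain u where u: "t = 2 * u" using assms(1) by auto
    \<comment> \<open>The \<open>t / 2\<close> equal exponentials add up in the exponent.\<close>
    have "of_nat u * (1 / of_nat t)\<^sup>2 = (1 / (2 * of_nat t) :: rat)"
      using assms(2) u by (simp add: power2_eq_square field_simps)
    then have sc: "scalar (of_nat u) * (scalar (1 / of_nat t))\<^sup>2 = scalar (1 / (2 * of_nat t))"
      by (simp only: scalar_power scalar_mult)
    have "t div 2 = u" using u by simp
    then have "of_nat (t div 2) * (hook_weight t)\<^sup>2 = x_var\<^sup>2 * scalar (1 / (2 * of_nat t))"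
      unfolding sc[symmetric] by (simp only: hook_weight_def power_mult_distrib scalar_of_nat mult.left_commute)
    then show ?thesis
      using assms(2) by (simp add: exp_gf_power exp_series_eq)
  qed
  also have "?\<Theta> = ?Q ^ (t div 2) * ?R"
  proof -
    \<comment> \<open>For \<open>g = 1\<close> the inner sums are
      \<open>card (beta_sets n n)\<close>. Since \<open>?P * ?Q = 1\<close>, multiplying by powers
      of \<open>?Q\<close> isolates \<open>?\<Theta>\<close>.\<close>
    have "?R = ?\<Theta> * ?P ^ (t div 2)"
      using gf_sym_sets[OF assms, of "\<lambda>_. 1"] gf_sym_sets_qpoch by simp
    then have "?Q ^ (t div 2) * ?R = ?\<Theta> * (?P * ?Q) ^ (t div 2)"
      by (simp only: power_mult_distrib mult_ac)
    also have "?P * ?Q = 1" by (rule gf_beta_sets) (use assms in simp)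
    finally show ?thesis by simp
  qed
  finally have eq: "gf SC sum_list ?w = ?Q ^ (t div 2) * ?R *
      exp_series (fps_const (x_var ^ 2 * scalar (1 / (2 * of_nat t))) * fps_X ^ (2 * t))" .
  have "finite_fibres SC sum_list"
    by (rule finite_fibres_reindex[OF bij_betw_maya_set size finite_fibres_sym_sets[OF assms]])
  from has_sum_gf[OF this, of ?w] show ?thesis
    unfolding eq by (simp only: mult.assoc)
qed

end
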